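(* Let $G$ be a countable group and let $K$ be an uncountable algebraically closed field. Let $X$ be an algebraic variety over $K$ and let $A=X(K)$. Let $\Sigma\subset A^G$ be a strongly irreducible algebraic sofic subshift. Suppose that $\tau\colon\Sigma\to\Sigma$ is the restriction of some $\sigma\in CA_{alg}(G,X,K)$. If $\tau$ is post-surjective, then $\tau$ is surjective.
   Context: Algebraic varieties. An algebraic variety over an algebraically closed field $K$ is a reduced $K$-scheme of finite type, identified with its set of $K$-points. Algebraic subvarieties are Zariski closed subsets. Cellular automata. For a group $G$ and a set $A$, elements of $A^G$ are maps $c\colon G\to A$, with shift action $(gc)(h)=c(g^{-1}h)$. A cellular automaton is a map $\sigma\colon A^G\to A^G$ for which there are a finite subset $M\subset G$ (a memory set) and a map $\mu\colon A^M\to A$ (a local defining map) with $(\sigma(c))(g)=\mu((g^{-1}c)|_M)$ for all $c\in A^G$, $g\in G$. The set $CA_{alg}(G,X,K)$ consists of the cellular automata $\sigma\colon A^G\to A^G$, $A=X(K)$, admitting a finite memory set $M$ whose local defining map $A^M\to A$ is induced by a $K$-morphism of algebraic varieties $X^M\to X$, where $X^M$ is the fibered product of copies of $X$ indexed by $M$. Subshifts. A subshift of $A^G$ is a $G$-invariant subset. For a finite $D\subset G$ and an algebraic subvariety $W\subset A^D$, the set $\Sigma(A^G;W,D)=\{x\in A^G : (gx)|_D\in W \text{ for all } g\in G\}$ is called an algebraic subshift of finite type. A subshift $\Lambda\subset A^G$ is an algebraic sofic subshift if $\Lambda=\rho(\Sigma')$ for some $\rho\in CA_{alg}(G,X,K)$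 and some algebraic subshift of finite type $\Sigma'\subset A^G$. A subshift $\Sigma\subset A^G$ is strongly irreducible if there is a finite subset $\Delta\subset G$ such that for all finite subsets $E,F\subset G$ with $E\Delta\cap F=\varnothing$ and all $x,y\in\Sigma$, there is $z\in\Sigma$ with $z|_E=x|_E$ and $z|_F=y|_F$. Post-surjectivity. Two configurations $c,d\in A^G$ are asymptotic if $c|_{G\setminus E}=d|_{G\setminus E}$ for some finite $E\subset G$. The map $\tau\colon\Sigma\to\Sigma$ is post-surjective if for all $x,y\in\Sigma$ with $y$ asymptotic to $\tau(x)$, there is $z\in\Sigma$ asymptotic to $x$ with $\tau(z)=y$. *)

theory Defs
  imports "HOL-Analysis.Analysis" "HOL-Computational_Algebra.Polynomial"
begin

section \<open>Algebraic varieties\<close>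

text \<open>
  A reduced scheme of finite type over an algebraically closed field \<open>K\<close>, identified with its set of
  \<open>K\<close>-points, is encoded in the sense of Serre: a set of points with its Zariski topology and
  its sheaf of regular \<open>K\<close>-valued functions, covered by finitely many open pieces isomorphic to affine
  algebraic sets. Varieties need be neither irreducible, nor separated, nor nonempty.

  \<open>regular X U f\<close> means that \<open>f\<close>, restricted to the open set \<open>U\<close>, is a section of the
  structure sheaf over \<open>U\<close>; the values of \<open>f\<close> outside \<open>U\<close> and the non-open \<open>U\<close> are irrelevant.
\<close>

record ('a, 'k) function_space =
  zariski :: "'a topology"
  regular :: "'a set \<Rightarrow> ('a \<Rightarrow> 'k) \<Rightarrow> bool"

abbreviation points :: "('a, 'k, 'z) function_space_scheme \<Rightarrow> 'a set" where
  "points X \<equiv> topspace (zariski X)"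

definition space_with_functions :: "('a, 'k::field) function_space \<Rightarrow> bool" where
  "space_with_functions X \<longleftrightarrow>
     (\<forall>U V f. openin (zariski X) U \<and> openin (zariski X) V \<and> V \<subseteq> U \<and> regular X U f \<longrightarrow> regular X V f) \<and>
     (\<forall>U f. openin (zariski X) U \<and>
        (\<forall>x\<in>U. \<exists>V g. openin (zariski X) V \<and> x \<in> V \<and> V \<subseteq> U \<and> regular X V g \<and> (\<forall>y\<in>V. f y = g y))
        \<longrightarrow> regular X U f) \<and>
     (\<forall>U. openin (zariski X) U \<longrightarrow>
        (\<forall>a. regular X U (\<lambda>_. a)) \<and>
        (\<forall>f g. regular X U f \<and> regular X U g \<longrightarrow>
           regular X U (\<lambda>x. f x + g x) \<and> regular X U (\<lambda>x. f x * g x)) \<and>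
        (\<forall>f. regular X U f \<longrightarrow>
           openin (zariski X) {x \<in> U. f x \<noteq> 0} \<and> regular X {x \<in> U. f x \<noteq> 0} (\<lambda>x. inverse (f x))))"

definition variety_morphism ::
    "('a, 'k) function_space \<Rightarrow> ('b, 'k) function_space \<Rightarrow> ('a \<Rightarrow> 'b) \<Rightarrow> bool" where
  "variety_morphism X Y f \<longleftrightarrow>
     continuous_map (zariski X) (zariski Y) f \<and>
     (\<forall>V h. openin (zariski Y) V \<and> regular Y V h \<longrightarrow> regular X {x \<in> points X. f x \<in> V} (h \<circ> f))"

definition isomorphic_spaces :: "('a, 'k) function_space \<Rightarrow> ('b, 'k) function_space \<Rightarrow> bool" where
  "isomorphic_spaces X Y \<longleftrightarrow>
     (\<exists>f g. variety_morphism X Y f \<and> variety_morphism Y X g \<and>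
        (\<forall>x\<in>points X. g (f x) = x) \<and> (\<forall>y\<in>points Y. f (g y) = y))"

definition open_subspace :: "('a, 'k) function_space \<Rightarrow> 'a set \<Rightarrow> ('a, 'k) function_space" where
  "open_subspace X U = \<lparr>zariski = subtopology (zariski X) U, regular = regular X\<rparr>"

definition affine_space :: "nat \<Rightarrow> (nat \<Rightarrow> 'k) set" where
  "affine_space n = {..<n} \<rightarrow>\<^sub>E UNIV"

inductive poly_function :: "nat \<Rightarrow> ((nat \<Rightarrow> 'k::field) \<Rightarrow> 'k) \<Rightarrow> bool" for n where
  const: "poly_function n (\<lambda>_. a)"
| coord: "i < n \<Longrightarrow> poly_function n (\<lambda>x. x i)"
| add: "poly_function n p \<Longrightarrow> poly_function n q \<Longrightarrow> poly_function n (\<lambda>x. p x + q x)"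
| mult: "poly_function n p \<Longrightarrow> poly_function n q \<Longrightarrow> poly_function n (\<lambda>x. p x * q x)"

definition zero_locus :: "nat \<Rightarrow> ((nat \<Rightarrow> 'k::field) \<Rightarrow> 'k) set \<Rightarrow> (nat \<Rightarrow> 'k) set" where
  "zero_locus n P = {x \<in> affine_space n. \<forall>p\<in>P. p x = 0}"

definition zariski_affine :: "nat \<Rightarrow> (nat \<Rightarrow> 'k::field) topology" where
  "zariski_affine n =
     topology (\<lambda>U. \<exists>P. (\<forall>p\<in>P. poly_function n p) \<and> U = affine_space n - zero_locus n P)"

lemma openin_zariski_affine:
  "openin (zariski_affine n) U \<longleftrightarrow>
     (\<exists>P. (\<forall>p\<in>P. poly_function n p) \<and> U = affine_space n - zero_locus n P)"
proof -
  let ?O = "\<lambda>U. \<exists>P. (\<forall>p\<in>P. poly_function n p) \<and> U = affine_space n - (zero_locus n P :: (nat \<Rightarrow> 'a) set)"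
  have "istopology ?O"
    unfolding istopology_def
  proof (intro conjI allI impI)
    fix S T :: "(nat \<Rightarrow> 'a) set" assume "?O S" "?O T"
    then obtain P Q where PQ: "\<forall>p\<in>P. poly_function n p" "S = affine_space n - zero_locus n P"
      "\<forall>p\<in>Q. poly_function n p" "T = affine_space n - zero_locus n Q" by blast
    let ?R = "{\<lambda>x. p x * q x | p q. p \<in> P \<and> q \<in> Q}"
    have "S \<inter> T = affine_space n - zero_locus n ?R"
      unfolding PQ zero_locus_def by (auto; fastforce)
    moreover have "\<forall>p\<in>?R. poly_function n p"
      using PQ by (auto intro: poly_function.mult)
    ultimately show "?O (S \<inter> T)" by blast
  next
    fix \<K> :: "(nat \<Rightarrow> 'a) set set" assume "\<forall>K\<in>\<K>. ?O K"
    then obtain P where P: "\<And>K. K \<in> \<K> \<Longrightarrow> (\<forall>p\<in>P K. poly_function n p) \<and> K = affine_space n - zero_locus n (P K)"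
      by metis
    have "\<Union>\<K> = affine_space n - zero_locus n (\<Union>(P ` \<K>))"
    proof -
      have "x \<in> \<Union>\<K> \<longleftrightarrow> x \<in> affine_space n - zero_locus n (\<Union>(P ` \<K>))" for x
      proof -
        have "x \<in> \<Union>\<K> \<longleftrightarrow> (\<exists>K\<in>\<K>. x \<in> affine_space n - zero_locus n (P K))" using P by blast
        also have "\<dots> \<longleftrightarrow> x \<in> affine_space n - zero_locus n (\<Union>(P ` \<K>))"
          unfolding zero_locus_def by auto
        finally show ?thesis .
      qed
      then show ?thesis by blast
    qed
    moreover have "\<forall>p\<in>\<Union>(P ` \<K>). poly_function n p" using P by auto
    ultimately show "?O (\<Union>\<K>)" by (intro exI conjI)
  qed
  then show ?thesis unfolding zariski_affine_def by (simp add: topology_inverse')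
qed

lemma openin_nonvanishing_polynomial:
  assumes "poly_function n p"
  shows "openin (zariski_affine n) {x \<in> affine_space n. p x \<noteq> 0}"
  unfolding openin_zariski_affine
  by (rule exI[of _ "{p}"]) (use assms in \<open>auto simp: zero_locus_def\<close>)

lemma topspace_zariski_affine: "topspace (zariski_affine n) = affine_space n"
proof (rule subset_antisym)
  show "topspace (zariski_affine n) \<subseteq> affine_space n"
    unfolding topspace_def using openin_zariski_affine by blast
  show "affine_space n \<subseteq> topspace (zariski_affine n)"
    using openin_nonvanishing_polynomial[OF poly_function.const[of n 1]]
    by (auto dest: openin_subset)
qed

text \<open>For \<open>V\<close> Zariski closed in \<open>K\<^sup>n\<close>, the regular functions on \<open>V\<close> are locally quotients of polynomials.\<close>

definition affine_set :: "nat \<Rightarrow> (nat \<Rightarrow> 'k::field) set \<Rightarrow> (nat \<Rightarrow> 'k, 'k) function_space" where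
  "affine_set n V =
     \<lparr>zariski = subtopology (zariski_affine n) V,
      regular = (\<lambda>U f. \<forall>x\<in>U. \<exists>N p q.
        openin (subtopology (zariski_affine n) V) N \<and> x \<in> N \<and> N \<subseteq> U \<and>
        poly_function n p \<and> poly_function n q \<and>
        (\<forall>y\<in>N. q y \<noteq> 0 \<and> f y = p y / q y))\<rparr>"

definition algebraic_variety :: "('a, 'k::field) function_space \<Rightarrow> bool" where
  "algebraic_variety X \<longleftrightarrow> space_with_functions X \<and>
     (\<exists>\<U>. finite \<U> \<and> (\<forall>U\<in>\<U>. openin (zariski X) U) \<and> \<Union>\<U> = points X \<and>
        (\<forall>U\<in>\<U>. \<exists>n V. closedin (zariski_affine n) V \<and>
           isomorphic_spaces (open_subspace X U) (affine_set n V)))"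

lemma space_affine_set:
  fixes V :: "(nat \<Rightarrow> 'k::field) set"
  assumes V: "V \<subseteq> affine_space n"
  shows "space_with_functions (affine_set n V)"
proof -
  let ?T = "subtopology (zariski_affine n) V"
  have D: "openin ?T {x \<in> U. p x \<noteq> 0}" if U: "openin ?T U" and p: "poly_function n p" for U p
  proof -
    obtain W where W: "openin (zariski_affine n) W" "U = W \<inter> V" using U unfolding openin_subtopology by blast
    have "{x \<in> U. p x \<noteq> 0} = (W \<inter> {x \<in> affine_space n. p x \<noteq> 0}) \<inter> V" using W V by auto
    then show ?thesis using W openin_nonvanishing_polynomial[OF p] by (auto simp: openin_subtopology)
  qed
  let ?R = "regular (affine_set n V)"
  have z: "zariski (affine_set n V) = ?T" by (simp add: affine_set_def)
  have Rd: "?R U f \<longleftrightarrow> (\<forall>x\<in>U. \<exists>N p q. openin ?T N \<and> x \<in> N \<and> N \<subseteq> U \<and>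
        poly_function n p \<and> poly_function n q \<and> (\<forall>y\<in>N. q y \<noteq> 0 \<and> f y = p y / q y))" for U f
    by (simp add: affine_set_def)
  have RdE: thesis
    if "?R U f" "x \<in> U" and "\<And>N p q. openin ?T N \<Longrightarrow> x \<in> N \<Longrightarrow> N \<subseteq> U \<Longrightarrow> poly_function n p \<Longrightarrow>
      poly_function n q \<Longrightarrow> \<forall>y\<in>N. q y \<noteq> 0 \<and> f y = p y / q y \<Longrightarrow> thesis" for U f x thesis
    using that(1)[unfolded Rd, rule_format, OF that(2)] by (elim exE conjE) (rule that(3))
  have neg: "?R {x \<in> U. f x \<noteq> 0} (\<lambda>x. inverse (f x))" "openin ?T {x \<in> U. f x \<noteq> 0}" if U: "openin ?T U" and f: "?R U f" for U f
  proof -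
    have nb: "\<exists>N p q. openin ?T N \<and> x \<in> N \<and> N \<subseteq> {x \<in> U. f x \<noteq> 0} \<and>
        poly_function n p \<and> poly_function n q \<and> (\<forall>y\<in>N. q y \<noteq> 0 \<and> inverse (f y) = p y / q y)"
      if x: "x \<in> {x \<in> U. f x \<noteq> 0}" for x
    proof -
      obtain N p q where N: "openin ?T N" "x \<in> N" "N \<subseteq> U" "poly_function n p" "poly_function n q"
        "\<forall>y\<in>N. q y \<noteq> 0 \<and> f y = p y / q y" by (rule RdE[OF f, of x]) (use x in auto)
      have "openin ?T {y\<in>N. p y \<noteq> 0}" by (rule D) (use N in auto)
      then show ?thesis using N x by - (rule exI[of _ "{y\<in>N. p y \<noteq> 0}"], rule exI[of _ q], rule exI[of _ p], auto)
    qed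
    show "?R {x \<in> U. f x \<noteq> 0} (\<lambda>x. inverse (f x))"
      unfolding Rd by (rule ballI, rule nb)
    have "\<exists>N. openin ?T N \<and> x \<in> N \<and> N \<subseteq> {x \<in> U. f x \<noteq> 0}" if "x \<in> {x \<in> U. f x \<noteq> 0}" for x
      using nb[OF that] by (elim exE conjE, intro exI conjI)
    then show "openin ?T {x \<in> U. f x \<noteq> 0}"
      by (intro openin_subopen[THEN iffD2]) (rule ballI)
  qed
  show ?thesis
    unfolding space_with_functions_def z
  proof (intro conjI allI impI)
    fix U V' f assume a: "openin ?T U \<and> openin ?T V' \<and> V' \<subseteq> U \<and> ?R U f"
    show "?R V' f" unfolding Rd
    proof
      fix x assume x: "x \<in> V'"
      obtain N p q where N: "openin ?T N" "x \<in> N" "N \<subseteq> U" "poly_function n p" "poly_function n q"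
        "\<forall>y\<in>N. q y \<noteq> 0 \<and> f y = p y / q y" by (rule RdE[of U f x]) (use a x in auto)
      show "\<exists>N p q. openin ?T N \<and> x \<in> N \<and> N \<subseteq> V' \<and>
        poly_function n p \<and> poly_function n q \<and> (\<forall>y\<in>N. q y \<noteq> 0 \<and> f y = p y / q y)"
        by (rule exI[of _ "N \<inter> V'"], rule exI[of _ p], rule exI[of _ q]) (use N x a in \<open>auto intro: openin_Int\<close>)
    qed
  next
    fix U f assume a: "openin ?T U \<and> (\<forall>x\<in>U. \<exists>V g. openin ?T V \<and> x \<in> V \<and> V \<subseteq> U \<and> ?R V g \<and> (\<forall>y\<in>V. f y = g y))"
    show "?R U f" unfolding Rd
    proof
      fix x assume "x \<in> U"
      then obtain V' g where V': "openin ?T V'" "x \<in> V'" "V' \<subseteq> U" "?R V' g" "\<forall>y\<in>V'. f y = g y" using a by blast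
      obtain N p q where N: "openin ?T N" "x \<in> N" "N \<subseteq> V'" "poly_function n p" "poly_function n q"
        "\<forall>y\<in>N. q y \<noteq> 0 \<and> g y = p y / q y" by (rule RdE[OF V'(4,2)])
      show "\<exists>N p q. openin ?T N \<and> x \<in> N \<and> N \<subseteq> U \<and>
        poly_function n p \<and> poly_function n q \<and> (\<forall>y\<in>N. q y \<noteq> 0 \<and> f y = p y / q y)"
        by (rule exI[of _ N], rule exI[of _ p], rule exI[of _ q]) (use N V' in auto)
    qed
  next
    fix U a assume "openin ?T U"
    then show "?R U (\<lambda>_. a)" unfolding Rd
      by - (rule ballI, rule exI[of _ U], rule exI[of _ "\<lambda>_. a"], rule exI[of _ "\<lambda>_. 1"],
        auto intro: poly_function.const)
  next
    fix U f g assume U: "openin ?T U" and fg: "?R U f \<and> ?R U g"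
    have key: "\<exists>N p q p' q'. openin ?T N \<and> x \<in> N \<and> N \<subseteq> U \<and> poly_function n p \<and> poly_function n q \<and>
       poly_function n p' \<and> poly_function n q' \<and>
       (\<forall>y\<in>N. q y \<noteq> 0 \<and> f y = p y / q y \<and> q' y \<noteq> 0 \<and> g y = p' y / q' y)" if x: "x \<in> U" for x
    proof -
      obtain N p q where N: "openin ?T N" "x \<in> N" "N \<subseteq> U" "poly_function n p" "poly_function n q"
        "\<forall>y\<in>N. q y \<noteq> 0 \<and> f y = p y / q y" by (rule RdE[OF fg[THEN conjunct1] x])
      obtain N' p' q' where N': "openin ?T N'" "x \<in> N'" "N' \<subseteq> U" "poly_function n p'" "poly_function n q'"
        "\<forall>y\<in>N'. q' y \<noteq> 0 \<and> g y = p' y / q' y" by (rule RdE[OF fg[THEN conjunct2] x])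
      show ?thesis
        by (rule exI[of _ "N \<inter> N'"], rule exI[of _ p], rule exI[of _ q], rule exI[of _ p'], rule exI[of _ q'])
          (use N N' in \<open>auto intro: openin_Int\<close>)
    qed
    show "?R U (\<lambda>x. f x + g x)" unfolding Rd
    proof
      fix x assume "x \<in> U"
      from key[OF this] obtain N p q p' q' where k: "openin ?T N" "x \<in> N" "N \<subseteq> U" "poly_function n p" "poly_function n q"
       "poly_function n p'" "poly_function n q'"
       "\<forall>y\<in>N. q y \<noteq> 0 \<and> f y = p y / q y \<and> q' y \<noteq> 0 \<and> g y = p' y / q' y" by blast
      show "\<exists>N p q. openin ?T N \<and> x \<in> N \<and> N \<subseteq> U \<and>
        poly_function n p \<and> poly_function n q \<and> (\<forall>y\<in>N. q y \<noteq> 0 \<and> f y + g y = p y / q y)"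
        by (rule exI[of _ N], rule exI[of _ "\<lambda>y. p y * q' y + p' y * q y"], rule exI[of _ "\<lambda>y. q y * q' y"])
          (use k in \<open>auto intro!: poly_function.intros simp: add_frac_eq\<close>)
    qed
    show "?R U (\<lambda>x. f x * g x)" unfolding Rd
    proof
      fix x assume "x \<in> U"
      from key[OF this] obtain N p q p' q' where k: "openin ?T N" "x \<in> N" "N \<subseteq> U" "poly_function n p" "poly_function n q"
       "poly_function n p'" "poly_function n q'"
       "\<forall>y\<in>N. q y \<noteq> 0 \<and> f y = p y / q y \<and> q' y \<noteq> 0 \<and> g y = p' y / q' y" by blast
      show "\<exists>N p q. openin ?T N \<and> x \<in> N \<and> N \<subseteq> U \<and>
        poly_function n p \<and> poly_function n q \<and> (\<forall>y\<in>N. q y \<noteq> 0 \<and> f y * g y = p y / q y)"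
        by (rule exI[of _ N], rule exI[of _ "\<lambda>y. p y * p' y"], rule exI[of _ "\<lambda>y. q y * q' y"])
          (use k in \<open>auto intro!: poly_function.intros\<close>)
    qed
  next
    fix U f assume "openin ?T U" "?R U f"
    then show "openin ?T {x \<in> U. f x \<noteq> 0}" "?R {x \<in> U. f x \<noteq> 0} (\<lambda>x. inverse (f x))"
      using neg by blast+
  qed
qed

lemma algebraic_variety_affine_set:
  assumes "closedin (zariski_affine n) V"
  shows "algebraic_variety (affine_set n V)"
proof -
  have V: "V \<subseteq> affine_space n" using assms closedin_subset topspace_zariski_affine by metis
  have [simp]: "points (affine_set n V) = V" using V by (auto simp: affine_set_def topspace_zariski_affine)
  have s: "space_with_functions (affine_set n V)" by (rule space_affine_set[OF V])
  have e: "open_subspace (affine_set n V) V = affine_set n V"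
    by (simp add: open_subspace_def affine_set_def subtopology_subtopology)
  have i: "variety_morphism (affine_set n V) (affine_set n V) (\<lambda>x. x)"
    unfolding variety_morphism_def
    by (auto simp: o_def dest!: openin_subset) (metis Collect_mem_eq Int_def inf.absorb_iff2)
  show ?thesis
    unfolding algebraic_variety_def
    by (intro conjI s exI[of _ "{V}"])
      (use e i assms in \<open>auto simp: isomorphic_spaces_def intro!: openin_topspace[of "zariski (affine_set n V)", simplified] exI[of _ n] exI[of _ V] exI[of _ "\<lambda>x. x"]\<close>)
qed


section \<open>Fibered powers\<close>

text \<open>
  \<open>power_variety X M\<close> is the fibered product over \<open>K\<close> of copies of \<open>X\<close> indexed by the finite set \<open>M\<close>. Its
  points are the maps from \<open>M\<close> to the points of \<open>X\<close>. On a box \<open>\<Prod>m\<in>M. U m\<close> of open sets,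
  the image of the tensor product of the rings of regular functions on the \<open>U m\<close> consists of the \<open>box_function\<close>s;
  the Zariski topology is generated by their non-vanishing loci (so it is
  finer than the product topology), and the regular functions are locally quotients of them. The
  coefficients \<open>a k\<close> matter for empty \<open>M\<close>, where the product is the one-point variety.
\<close>

definition box_function ::
    "('a, 'k::field) function_space \<Rightarrow> 'i set \<Rightarrow> ('i \<Rightarrow> 'a set) \<Rightarrow> (('i \<Rightarrow> 'a) \<Rightarrow> 'k) \<Rightarrow> bool" where
  "box_function X M U h \<longleftrightarrow>
     (\<exists>(r::nat) a F. (\<forall>k<r. \<forall>m\<in>M. regular X (U m) (F k m)) \<and>
        (\<forall>x\<in>PiE M U. h x = (\<Sum>k<r. a k * (\<Prod>m\<in>M. F k m (x m)))))"

definition zariski_power :: "('a, 'k::field) function_space \<Rightarrow> 'i set \<Rightarrow> ('i \<Rightarrow> 'a) topology" where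
  "zariski_power X M = topology_generated_by
     {{x \<in> PiE M U. h x \<noteq> 0} | U h. (\<forall>m\<in>M. openin (zariski X) (U m)) \<and> box_function X M U h}"

definition power_variety :: "('a, 'k::field) function_space \<Rightarrow> 'i set \<Rightarrow> ('i \<Rightarrow> 'a, 'k) function_space" where
  "power_variety X M =
     \<lparr>zariski = zariski_power X M,
      regular = (\<lambda>W f. \<forall>x\<in>W. \<exists>N U g h.
        openin (zariski_power X M) N \<and> x \<in> N \<and> N \<subseteq> W \<and> N \<subseteq> PiE M U \<and>
        (\<forall>m\<in>M. openin (zariski X) (U m)) \<and> box_function X M U g \<and> box_function X M U h \<and>
        (\<forall>y\<in>N. h y \<noteq> 0 \<and> f y = g y / h y))\<rparr>"

lemma const_box:
  assumes X: "space_with_functions X" and U: "\<forall>m\<in>M. openin (zariski X) (U m)"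
  shows "box_function X M U (\<lambda>_. 1)"
proof -
  have c: "regular X V (\<lambda>_. a)" if "openin (zariski X) V" for V a
    using X that unfolding space_with_functions_def by blast
  show ?thesis
    unfolding box_function_def
    by (rule exI[of _ 1], rule exI[of _ "\<lambda>_. 1"], rule exI[of _ "\<lambda>_ _ _. 1"]) (use U c in auto)
qed

lemma openin_box:
  assumes "space_with_functions X" and "\<forall>m\<in>M. openin (zariski X) (U m)"
  shows "openin (zariski_power X M) (PiE M U)"
  unfolding zariski_power_def
  by (rule topology_generated_by_Basis)
    (use assms const_box[OF assms] in \<open>auto intro!: exI[of _ U] exI[of _ "\<lambda>_. 1"]\<close>)

lemma points_power:
  assumes "space_with_functions X"
  shows "topspace (zariski_power X M) = M \<rightarrow>\<^sub>E points X"
proof (rule subset_antisym)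
  show "topspace (zariski_power X M) \<subseteq> M \<rightarrow>\<^sub>E points X"
    unfolding zariski_power_def topology_generated_by_topspace
    by (auto simp: PiE_iff extensional_def dest!: openin_subset)
  show "M \<rightarrow>\<^sub>E points X \<subseteq> topspace (zariski_power X M)"
    by (rule openin_subset, rule openin_box) (use assms in auto)
qed

text \<open>The universal property of the fibered product:\<close>

lemma power_universal_projection:
  assumes X: "space_with_functions X" and M: "finite M" "m \<in> M"
  shows "variety_morphism (power_variety X M) X (\<lambda>x. x m)"
proof -
  have one: "regular X U (\<lambda>_. a)" if "openin (zariski X) U" for U a
    using X that unfolding space_with_functions_def by blast
  note box1 = const_box[OF X] and boxo = openin_box[OF X] and top = points_power[OF X, of M]
  have pre: "{x \<in> topspace (zariski_power X M). x m \<in> V} = PiE M (\<lambda>i. if i = m then V else points X)"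
    if "openin (zariski X) V" for V
  proof (rule subset_antisym)
    show "{x \<in> topspace (zariski_power X M). x m \<in> V} \<subseteq> PiE M (\<lambda>i. if i = m then V else points X)"
      unfolding top by (auto simp: PiE_iff extensional_def)
    have "PiE M (\<lambda>i. if i = m then V else points X) \<subseteq> M \<rightarrow>\<^sub>E points X"
      by (rule PiE_mono) (use openin_subset[OF that] in auto)
    moreover have "x m \<in> V" if "x \<in> PiE M (\<lambda>i. if i = m then V else points X)" for x
      using PiE_mem[OF that M(2)] by simp
    ultimately show "PiE M (\<lambda>i. if i = m then V else points X) \<subseteq> {x \<in> topspace (zariski_power X M). x m \<in> V}"
      unfolding top by blast
  qed
  have preo: "openin (zariski_power X M) {x \<in> topspace (zariski_power X M). x m \<in> V}" if V: "openin (zariski X) V" for V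
    unfolding pre[OF V] by (rule boxo) (use V in auto)
  show ?thesis
    unfolding variety_morphism_def
  proof (intro conjI allI impI)
    show "continuous_map (zariski (power_variety X M)) (zariski X) (\<lambda>x. x m)"
      unfolding continuous_map_def using preo M top by (auto simp: power_variety_def PiE_iff)
    fix V h assume a: "openin (zariski X) V \<and> regular X V h"
    let ?U = "\<lambda>i. if i = m then V else points X"
    let ?N = "PiE M ?U"
    have Uo: "\<forall>i\<in>M. openin (zariski X) (?U i)" using a by auto
    have b: "box_function X M ?U (\<lambda>x. h (x m))"
      unfolding box_function_def
    proof (rule exI[of _ 1], rule exI[of _ "\<lambda>_. 1"], rule exI[of _ "\<lambda>_ i x. if i = m then h x else 1"], intro conjI allI impI ballI)
      fix i assume "i \<in> M"
      show "regular X (?U i) (\<lambda>x. if i = m then h x else 1)"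
        using a one[of "points X" 1] by (cases "i = m") auto
    next
      fix x assume "x \<in> PiE M ?U"
      show "h (x m) = (\<Sum>k<(1::nat). 1 * (\<Prod>i\<in>M. if i = m then h (x i) else 1))"
        using M by (simp add: prod.delta)
    qed
    show "regular (power_variety X M) {x \<in> points (power_variety X M). x m \<in> V} (h \<circ> (\<lambda>x. x m))"
    proof -
      have e: "{x \<in> points (power_variety X M). x m \<in> V} = ?N"
        using pre a by (simp add: power_variety_def)
      show ?thesis
        unfolding e unfolding power_variety_def function_space.simps
      proof (rule ballI, rule exI[of _ ?N], rule exI[of _ ?U], rule exI[of _ "\<lambda>x. h (x m)"],
          rule exI[of _ "\<lambda>_. 1"], intro conjI)
        show "openin (zariski_power X M) ?N" by (rule boxo[OF Uo])
        show "box_function X M ?U (\<lambda>_. 1)" by (rule box1[OF Uo])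
      qed (use Uo b in simp_all)
    qed
  qed
qed


lemma power_universal_tuple:
  assumes X: "space_with_functions X" and Y: "space_with_functions Y" and M: "finite M"
    and f: "\<And>m. m \<in> M \<Longrightarrow> variety_morphism Y X (f m)"
  shows "variety_morphism Y (power_variety X M) (\<lambda>y. restrict (\<lambda>m. f m y) M)"
proof -
  note top = points_power[OF X, of M]
  let ?t = "\<lambda>y. restrict (\<lambda>m. f m y) M"
  let ?O = "openin (zariski Y)"
  note S = Y[unfolded space_with_functions_def]
  have sub: "regular Y V g" if "?O U" "?O V" "V \<subseteq> U" "regular Y U g" for U V g
    by (rule S[THEN conjunct1, rule_format, of U V g]) (intro conjI that)
  have glue: "regular Y U g" if "?O U" "\<And>x. x \<in> U \<Longrightarrow> \<exists>V h. ?O V \<and> x \<in> V \<and> V \<subseteq> U \<and> regular Y V h \<and> (\<forall>y\<in>V. g y = h y)" for U g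
    by (rule S[THEN conjunct2, THEN conjunct1, rule_format, of U g]) (intro conjI ballI that)
  note A = S[THEN conjunct2, THEN conjunct2, rule_format]
  have cn: "regular Y U (\<lambda>_. a)" if "?O U" for U a
    using A[OF that] by blast
  have ad: "regular Y U (\<lambda>x. g x + h x)" "regular Y U (\<lambda>x. g x * h x)" if "?O U" "regular Y U g" "regular Y U h" for U g h
    using A[OF that(1), THEN conjunct2, THEN conjunct1, rule_format, of g h] that by simp_all
  have nv: "?O {x\<in>U. g x \<noteq> 0}" "regular Y {x \<in> U. g x \<noteq> 0} (\<lambda>x. inverse (g x))" if "?O U" "regular Y U g" for U g
    using A[OF that(1), THEN conjunct2, THEN conjunct2, rule_format, of g] that by simp_all
  have su: "regular Y U (\<lambda>x. \<Sum>k\<in>S. g k x)" if "finite S" "?O U" "\<And>k. k \<in> S \<Longrightarrow> regular Y U (g k)" for U S and g :: "nat \<Rightarrow> _"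
    using that by (induction S rule: finite_induct) (auto intro: cn ad)
  have pr: "regular Y U (\<lambda>x. \<Prod>k\<in>S. g k x)" if "finite S" "?O U" "\<And>k. k \<in> S \<Longrightarrow> regular Y U (g k)" for U S and g :: "_ \<Rightarrow> _"
    using that by (induction S rule: finite_induct) (auto intro: cn ad)
  define P where "P U = {y \<in> points Y. \<forall>m\<in>M. f m y \<in> U m}" for U
  have Po: "?O (P U)" if U: "\<forall>m\<in>M. openin (zariski X) (U m)" for U
  proof -
    have e: "P U = points Y \<inter> (\<Inter>m\<in>M. {y\<in>points Y. f m y \<in> U m})" unfolding P_def by auto
    have o: "?O {y\<in>points Y. f m y \<in> U m}" if "m \<in> M" for m
      using f[OF that] U that unfolding variety_morphism_def continuous_map_def by blast
    show ?thesis
    proof (cases "M = {}")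
      case True then show ?thesis by (simp add: e)
    next
      case False then show ?thesis unfolding e
        by (intro openin_Int openin_topspace openin_Inter) (use o M in auto)
    qed
  qed
  have tin: "?t y \<in> PiE M U \<longleftrightarrow> (\<forall>m\<in>M. f m y \<in> U m)" for y U by (auto simp: PiE_iff)
  have pb: "regular Y (P U) (\<lambda>y. h (?t y))" if U: "\<forall>m\<in>M. openin (zariski X) (U m)" and h: "box_function X M U h" for U h
  proof -
    obtain r a F where rF: "\<forall>k<r. \<forall>m\<in>M. regular X (U m) (F k m)"
        "\<forall>x\<in>PiE M U. h x = (\<Sum>k<(r::nat). a k * (\<Prod>m\<in>M. F k m (x m)))" using h unfolding box_function_def by blast
    have "regular Y (P U) (\<lambda>y. \<Sum>k<r. a k * (\<Prod>m\<in>M. F k m (f m y)))"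
    proof (intro su ad cn pr Po[OF U] M)
      fix k m assume "k \<in> {..<r}" "m \<in> M"
      then have "regular Y {y\<in>points Y. f m y \<in> U m} (F k m \<circ> f m)" "?O {y\<in>points Y. f m y \<in> U m}"
        using f[of m] U rF unfolding variety_morphism_def continuous_map_def by auto
      from sub[OF this(2) Po[OF U] _ this(1)] \<open>m \<in> M\<close> show "regular Y (P U) (\<lambda>y. F k m (f m y))" by (auto simp: P_def o_def)
    qed auto
    moreover have "h (?t y) = (\<Sum>k<r. a k * (\<Prod>m\<in>M. F k m (f m y)))" if "y \<in> P U" for y
    proof -
      have "?t y \<in> PiE M U" using that by (auto simp: P_def)
      then show ?thesis using rF(2) by simp
    qed
    ultimately show ?thesis
      by (intro glue[OF Po[OF U]] exI[of _ "P U"] exI[of _ "\<lambda>y. \<Sum>k<r. a k * (\<Prod>m\<in>M. F k m (f m y))"])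
        (simp add: Po[OF U])
  qed
  have cont: "continuous_map (zariski Y) (zariski_power X M) ?t"
    unfolding zariski_power_def
  proof (rule continuous_on_generated_topo)
    show "?t ` points Y \<subseteq> \<Union> {{x \<in> PiE M U. h x \<noteq> 0} |U h. (\<forall>m\<in>M. openin (zariski X) (U m)) \<and> box_function X M U h}"
      using top f unfolding zariski_power_def topology_generated_by_topspace
      by (force simp: variety_morphism_def continuous_map_def)
    fix V assume "V \<in> {{x \<in> PiE M U. h x \<noteq> 0} |U h. (\<forall>m\<in>M. openin (zariski X) (U m)) \<and> box_function X M U h}"
    then obtain U h where V: "V = {x \<in> PiE M U. h x \<noteq> 0}" "\<forall>m\<in>M. openin (zariski X) (U m)" "box_function X M U h" by blast
    have "?t -` V \<inter> points Y = {y \<in> P U. h (?t y) \<noteq> 0}" unfolding V P_def using tin by auto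
    then show "?O (?t -` V \<inter> points Y)" using nv(1)[OF Po[OF V(2)] pb[OF V(2,3)]] by simp
  qed
  show ?thesis unfolding variety_morphism_def
  proof (intro conjI allI impI)
    show "continuous_map (zariski Y) (zariski (power_variety X M)) ?t" using cont by (simp add: power_variety_def)
    fix W h assume W: "openin (zariski (power_variety X M)) W \<and> regular (power_variety X M) W h"
    then have W': "openin (zariski_power X M) W" by (simp add: power_variety_def)
    have op: "?O {y \<in> points Y. ?t y \<in> N}" if "openin (zariski_power X M) N" for N
      using cont that unfolding continuous_map_def by blast
    show "regular Y {y \<in> points Y. ?t y \<in> W} (h \<circ> ?t)"
    proof (rule glue[OF op[OF W']])
      fix y assume y: "y \<in> {y \<in> points Y. ?t y \<in> W}"
      then obtain N U a b where N: "openin (zariski_power X M) N" "?t y \<in> N" "N \<subseteq> W" "N \<subseteq> PiE M U"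
        "\<forall>m\<in>M. openin (zariski X) (U m)" "box_function X M U a" "box_function X M U b"
        "\<forall>y\<in>N. b y \<noteq> 0 \<and> h y = a y / b y"
        using W unfolding power_variety_def by auto
      let ?Q = "{y \<in> points Y. ?t y \<in> N}"
      have QP: "?Q \<subseteq> {y\<in>P U. b (?t y) \<noteq> 0}" using N(4,8) tin unfolding P_def by blast
      have Qo: "?O ?Q" by (rule op[OF N(1)])
      have "regular Y ?Q (\<lambda>y. a (?t y))" by (rule sub[OF Po[OF N(5)] Qo _ pb[OF N(5,6)]]) (use QP in blast)
      moreover have "regular Y ?Q (\<lambda>y. inverse (b (?t y)))"
        by (rule sub[OF nv(1)[OF Po[OF N(5)] pb[OF N(5,7)]] Qo QP nv(2)[OF Po[OF N(5)] pb[OF N(5,7)]]])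
      ultimately have "regular Y ?Q (\<lambda>y. a (?t y) * inverse (b (?t y)))" by (rule ad(2)[OF Qo])
      then show "\<exists>V g. ?O V \<and> y \<in> V \<and> V \<subseteq> {y \<in> points Y. ?t y \<in> W} \<and> regular Y V g \<and> (\<forall>y\<in>V. (h \<circ> ?t) y = g y)"
        by (intro exI[of _ ?Q] exI[of _ "\<lambda>y. a (?t y) * inverse (b (?t y))"] conjI Qo)
          (use N y in \<open>auto simp: divide_inverse\<close>)
    qed
  qed
qed


section \<open>Cellular automata and subshifts\<close>

text \<open>The group \<open>G\<close> is the type \<open>'g\<close>, written additively but not assumed to be commutative.\<close>

definition configurations :: "'a set \<Rightarrow> ('g \<Rightarrow> 'a) set" where
  "configurations A = UNIV \<rightarrow> A"

definition shift :: "'g::group_add \<Rightarrow> ('g \<Rightarrow> 'a) \<Rightarrow> ('g \<Rightarrow> 'a)" where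
  "shift g c = (\<lambda>h. c (- g + h))"

definition local_defining_map ::
    "'a set \<Rightarrow> 'g::group_add set \<Rightarrow> (('g \<Rightarrow> 'a) \<Rightarrow> 'a) \<Rightarrow> (('g \<Rightarrow> 'a) \<Rightarrow> ('g \<Rightarrow> 'a)) \<Rightarrow> bool" where
  "local_defining_map A M \<mu> \<sigma> \<longleftrightarrow> finite M \<and> \<mu> \<in> (M \<rightarrow>\<^sub>E A) \<rightarrow> A \<and>
     (\<forall>c\<in>configurations A. \<forall>g. \<sigma> c g = \<mu> (restrict (shift (- g) c) M))"

definition CA_alg :: "('a, 'k::field) function_space \<Rightarrow> (('g::group_add \<Rightarrow> 'a) \<Rightarrow> ('g \<Rightarrow> 'a)) set" where
  "CA_alg X = {\<sigma>. \<exists>M \<mu>. local_defining_map (points X) M \<mu> \<sigma> \<and>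
                        variety_morphism (power_variety X M) X \<mu>}"

definition subshift :: "'a set \<Rightarrow> ('g::group_add \<Rightarrow> 'a) set \<Rightarrow> bool" where
  "subshift A \<Lambda> \<longleftrightarrow> \<Lambda> \<subseteq> configurations A \<and> (\<forall>g. \<forall>c\<in>\<Lambda>. shift g c \<in> \<Lambda>)"

definition sft :: "'a set \<Rightarrow> ('g::group_add \<Rightarrow> 'a) set \<Rightarrow> 'g set \<Rightarrow> ('g \<Rightarrow> 'a) set" where
  "sft A W D = {x \<in> configurations A. \<forall>g. restrict (shift g x) D \<in> W}"

definition algebraic_sft :: "('a, 'k::field) function_space \<Rightarrow> ('g::group_add \<Rightarrow> 'a) set \<Rightarrow> bool" where
  "algebraic_sft X \<Lambda> \<longleftrightarrow>
     (\<exists>D W. finite D \<and> closedin (zariski (power_variety X D)) W \<and> \<Lambda> = sft (points X) W D)"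

definition algebraic_sofic_subshift ::
    "('a, 'k::field) function_space \<Rightarrow> ('g::group_add \<Rightarrow> 'a) set \<Rightarrow> bool" where
  "algebraic_sofic_subshift X \<Lambda> \<longleftrightarrow> subshift (points X) \<Lambda> \<and>
     (\<exists>\<rho>\<in>CA_alg X. \<exists>\<Lambda>'. algebraic_sft X \<Lambda>' \<and> \<Lambda> = \<rho> ` \<Lambda>')"

definition strongly_irreducible :: "('g::group_add \<Rightarrow> 'a) set \<Rightarrow> bool" where
  "strongly_irreducible \<Lambda> \<longleftrightarrow>
     (\<exists>\<Delta>. finite \<Delta> \<and>
        (\<forall>E F. finite E \<and> finite F \<and> {e + d | e d. e \<in> E \<and> d \<in> \<Delta>} \<inter> F = {} \<longrightarrow>
           (\<forall>x\<in>\<Lambda>. \<forall>y\<in>\<Lambda>. \<exists>z\<in>\<Lambda>. restrict z E = restrict x E \<and> restrict z F = restrict y F)))"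

definition asymptotic :: "('g \<Rightarrow> 'a) \<Rightarrow> ('g \<Rightarrow> 'a) \<Rightarrow> bool" where
  "asymptotic c d \<longleftrightarrow> (\<exists>E. finite E \<and> restrict c (- E) = restrict d (- E))"

definition post_surjective :: "('g \<Rightarrow> 'a) set \<Rightarrow> (('g \<Rightarrow> 'a) \<Rightarrow> ('g \<Rightarrow> 'a)) \<Rightarrow> bool" where
  "post_surjective \<Lambda> \<tau> \<longleftrightarrow>
     (\<forall>x\<in>\<Lambda>. \<forall>y\<in>\<Lambda>. asymptotic y (\<tau> x) \<longrightarrow> (\<exists>z\<in>\<Lambda>. asymptotic z x \<and> \<tau> z = y))"

end

theory Submission
  imports Defs "HOL-Library.Function_Algebras"
begin

text \<open>
  Over an uncountable algebraically closed field \<open>K\<close>, every proper ideal of a polynomial ring in countably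
  many variables has a zero: modulo a maximal ideal \<open>m\<close>, a variable \<open>z\<close> with all \<open>z - a \<notin> m\<close> would give
  uncountably many inverses of the \<open>z - a\<close> in a \<open>K\<close>-algebra of countable dimension, hence a nonzero polynomial in \<open>z\<close>
  that lies in \<open>m\<close>, and one of its linear factors would lie in \<open>m\<close>. So algebraic sets in countably many variables are
  compact in the Zariski topology. For countable \<open>G\<close>, all configurations are the coordinatewise
  algebraic image of such a set. Therefore a configuration whose finite patterns are all realised
  by the image of an algebraic subshift of finite type under a composition of algebraic cellular automata is itself in
  the image; in particular \<open>\<Sigma>\<close> and \<open>\<tau>(\<Sigma>)\<close> are closed.

  Given \<open>y \<in> \<Sigma>\<close> and a finite \<open>E\<close>, strong irreducibility and closedness of \<open>\<Sigma>\<close> give \<open>z \<in> \<Sigma>\<close> that agrees with \<open>y\<close> on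
  \<open>E\<close> and with \<open>\<tau> y\<close> outside a finite set. Post-surjectivity puts \<open>z\<close> in \<open>\<tau>(\<Sigma>)\<close>, so \<open>\<tau>(\<Sigma>)\<close> is dense, hence equal to \<open>\<Sigma>\<close>.
\<close>

section \<open>The Nullstellensatz in countably many variables\<close>

text \<open>Polynomials are represented by the functions they induce, which is faithful over an
  infinite field; each involves only finitely many of the variables \<open>z i\<close>, however
  large \<open>'i\<close> is.\<close>

inductive poly_map :: "(('i \<Rightarrow> 'k::comm_ring_1) \<Rightarrow> 'k) \<Rightarrow> bool" where
  const: "poly_map (\<lambda>_. a)"
| coord: "poly_map (\<lambda>z. z i)"
| add: "poly_map p \<Longrightarrow> poly_map q \<Longrightarrow> poly_map (\<lambda>z. p z + q z)"
| mult: "poly_map p \<Longrightarrow> poly_map q \<Longrightarrow> poly_map (\<lambda>z. p z * q z)"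

lemma poly_map_diff:
  assumes "poly_map p" "poly_map q"
  shows "poly_map (\<lambda>z. p z - q z)"
  using poly_map.add[OF assms(1) poly_map.mult[OF poly_map.const[of "- 1"] assms(2)]] by simp

lemma poly_map_prod:
  "finite S \<Longrightarrow> (\<And>s. s \<in> S \<Longrightarrow> poly_map (p s)) \<Longrightarrow> poly_map (\<lambda>z. \<Prod>s\<in>S. p s z)"
  by (induction S rule: finite_induct) (auto intro: poly_map.intros)

section \<open>Linear dependence in spaces of functions\<close>

lemma sum_fun_apply: "(\<Sum>a\<in>S. f a) x = (\<Sum>a\<in>S. f a x :: 'k::comm_monoid_add)"
  by (induction S rule: infinite_finite_induct) auto

lemma vector_space_fun: "vector_space (\<lambda>(c::'k::field) f x. c * f x :: 'k)"
  by unfold_locales (auto simp: fun_eq_iff algebra_simps)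

abbreviation fun_span :: "('b \<Rightarrow> 'k::field) set \<Rightarrow> ('b \<Rightarrow> 'k) set" where
  "fun_span \<equiv> module.span (\<lambda>c f x. c * f x)"

text \<open>Each \<open>g a\<close> already lies in the span of a finite subset of \<open>B\<close>,
  and there are only countably many of these, so a single finite \<open>T\<close> serves infinitely
  many indices. Infinitely many distinct vectors in the span of \<open>T\<close> are dependent; a
  repeated value of the family is itself a relation.\<close>

lemma uncountable_family_dependent:
  fixes g :: "'a \<Rightarrow> 'b \<Rightarrow> 'k::field"
  assumes A: "uncountable (UNIV :: 'a set)" and B: "countable B" and g: "\<And>a. g a \<in> fun_span B"
  shows "\<exists>S c. finite S \<and> (\<forall>x. (\<Sum>a\<in>S. c a * g a x) = 0) \<and> (\<exists>a\<in>S. c a \<noteq> 0)"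
proof -
  interpret vector_space "\<lambda>(c::'k) (f :: 'b \<Rightarrow> 'k) x. c * f x" by (rule vector_space_fun)
  have "\<exists>t. finite t \<and> t \<subseteq> B \<and> g a \<in> span t" for a
  proof -
    obtain t r where t: "finite t" "t \<subseteq> B" "g a = (\<Sum>f\<in>t. (\<lambda>x. r f * f x))"
      using g[of a] unfolding span_explicit[of B] by blast
    then have "g a \<in> span t" by (simp add: span_sum span_scale span_base)
    then show ?thesis using t by blast
  qed
  then obtain t where t: "\<And>a. finite (t a)" "\<And>a. t a \<subseteq> B" "\<And>a. g a \<in> span (t a)"
    by metis
  have "countable (range t)"
    by (rule countable_subset[OF _ countable_Collect_finite_subset[OF B]]) (use t in auto)
  have "\<exists>T. infinite (t -` {T})"
  proof (rule ccontr)
    assume "\<nexists>T. infinite (t -` {T})"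
    then have "countable (t -` {T})" for T by (simp add: countable_finite)
    moreover have "UNIV = (\<Union>T\<in>range t. t -` {T})" by auto
    ultimately show False
      using A \<open>countable (range t)\<close> by (metis countable_UN)
  qed
  then obtain T where T: "infinite (t -` {T})" by blast
  let ?Q = "t -` {T}"
  have fT: "finite T" using T t(1) by (metis infinite_imp_nonempty vimage_singleton_eq all_not_in_conv)
  show ?thesis
  proof (cases "inj_on g ?Q")
    case True
    have "g ` ?Q \<subseteq> span T" using t(3) by auto
    moreover have "infinite (g ` ?Q)" using T True by (simp add: finite_image_iff)
    ultimately have "dependent (g ` ?Q)" using independent_span_bound[OF fT] by blast
    then obtain V u where V: "finite V" "V \<subseteq> g ` ?Q" "(\<Sum>v\<in>V. (\<lambda>x. u v * v x)) = 0" "\<exists>v\<in>V. u v \<noteq> 0"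
      unfolding dependent_explicit by blast
    from V(1,2) obtain S where S: "S \<subseteq> ?Q" "finite S" "V = g ` S"
      using finite_subset_image by metis
    have inj: "inj_on g S" using True S(1) inj_on_subset by blast
    have "(\<Sum>a\<in>S. u (g a) * g a x) = 0" for x
      using fun_cong[OF V(3), of x] by (simp add: S(3) sum.reindex[OF inj] sum_fun_apply)
    then show ?thesis using S V(4) by (intro exI[of _ S] exI[of _ "u \<circ> g"]) auto
  next
    case False
    then obtain a b where ab: "a \<noteq> b" "g a = g b" by (auto simp: inj_on_def)
    then show ?thesis by (intro exI[of _ "{a,b}"] exI[of _ "\<lambda>s. if s = a then 1 else - 1"]) auto
  qed
qed

text \<open>Lists of variables encode monomials and concatenation multiplies them, so their span is
  closed under products. With lists, countability of the monomials for countable \<open>'i\<close>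
  is immediate.\<close>

lemma poly_map_in_span:
  fixes p :: "('i \<Rightarrow> 'k::field) \<Rightarrow> 'k"
  assumes "poly_map p"
  shows "p \<in> fun_span (range (\<lambda>l z. prod_list (map z l)))"
proof -
  interpret vector_space "\<lambda>(c::'k) (f :: ('i \<Rightarrow> 'k) \<Rightarrow> 'k) x. c * f x" by (rule vector_space_fun)
  let ?B = "range (\<lambda>l (z :: 'i \<Rightarrow> 'k). prod_list (map z l))"
  have mono: "(\<lambda>z. prod_list (map z l)) \<in> span ?B" for l by (rule span_base) blast
  \<comment> \<open>Bilinear expansion in two stages: here one factor is a single monomial, in
    \<open>mult\<close> both are arbitrary elements of the span.\<close>
  have mult1: "(\<lambda>z. prod_list (map z l) * q z) \<in> span ?B" if "q \<in> span ?B" for l q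
    using that
  proof (induction rule: span_induct_alt)
    case base
    show ?case using span_zero by (simp add: zero_fun_def)
  next
    case (step c x y)
    then obtain l' where "x = (\<lambda>z. prod_list (map z l'))" by blast
    then have "(\<lambda>z. prod_list (map z l) * ((\<lambda>z. c * x z) + y) z)
        = (\<lambda>z. c * prod_list (map z (l @ l'))) + (\<lambda>z. prod_list (map z l) * y z)"
      by (auto simp: fun_eq_iff algebra_simps)
    then show ?case using span_add[OF span_scale[OF mono, of c "l @ l'"] step(2)] by simp
  qed
  have mult: "(\<lambda>z. p z * q z) \<in> span ?B" if "p \<in> span ?B" "q \<in> span ?B" for p q
    using that(1)
  proof (induction rule: span_induct_alt)
    case base
    show ?case using span_zero by (simp add: zero_fun_def)
  next
    case (step c x y)
    then obtain l where "x = (\<lambda>z. prod_list (map z l))" by blast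
    then have "(\<lambda>z. ((\<lambda>z. c * x z) + y) z * q z)
        = (\<lambda>z. c * (prod_list (map z l) * q z)) + (\<lambda>z. y z * q z)"
      by (auto simp: fun_eq_iff algebra_simps)
    then show ?case using span_add[OF span_scale[OF mult1[OF that(2)], of c l] step(2)] by simp
  qed
  show ?thesis
    using assms
  proof induction
    case (const a)
    show ?case using span_scale[OF mono[of "[]"], of a] by simp
  next
    case (coord i)
    show ?case using mono[of "[i]"] by simp
  next
    case (add p q)
    then show ?case using span_add by (fastforce simp: plus_fun_def)
  qed (rule mult)
qed

text \<open>Properness is part of the locale, so a \<open>poly_ideal\<close> that is maximal under
  inclusion is a maximal ideal in the usual sense.\<close>

locale poly_ideal =
  fixes J :: "(('i \<Rightarrow> 'k::field) \<Rightarrow> 'k) set"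
  assumes poly: "f \<in> J \<Longrightarrow> poly_map f"
    and zero: "(\<lambda>_. 0) \<in> J"
    and add: "f \<in> J \<Longrightarrow> g \<in> J \<Longrightarrow> (\<lambda>z. f z + g z) \<in> J"
    and mult: "f \<in> J \<Longrightarrow> poly_map g \<Longrightarrow> (\<lambda>z. g z * f z) \<in> J"
    and proper: "(\<lambda>_. 1) \<notin> J"
begin

lemma sum: "finite S \<Longrightarrow> (\<And>s. s \<in> S \<Longrightarrow> f s \<in> J) \<Longrightarrow> (\<lambda>z. \<Sum>s\<in>S. f s z) \<in> J"
  by (induction S rule: finite_induct) (auto intro: zero add)

lemma const: "(\<lambda>_. c) \<in> J \<longleftrightarrow> c = 0"
  using mult[of "\<lambda>_. c" "\<lambda>_. inverse c"] proper zero poly_map.const by (cases "c = 0") auto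

end

text \<open>In effect the residue field of \<open>J\<close> is \<open>'k\<close>: its countable
  dimension excludes transcendental elements, and algebraic closedness then leaves only
  constants.\<close>

lemma maximal_poly_ideal_coordinate:
  fixes J :: "(('i \<Rightarrow> 'k::alg_closed_field) \<Rightarrow> 'k) set"
  assumes K: "uncountable (UNIV :: 'k set)" and I: "countable (UNIV :: 'i set)"
    and J: "poly_ideal J" and max: "\<And>J'. poly_ideal J' \<Longrightarrow> J \<subseteq> J' \<Longrightarrow> J' = J"
  shows "\<exists>a. (\<lambda>z. z i - a) \<in> J"
proof (rule ccontr)
  assume no: "\<nexists>a. (\<lambda>z. z i - a) \<in> J"
  interpret poly_ideal J by (rule J)
  have inv: "\<exists>g. poly_map g \<and> (\<lambda>z. 1 - g z * f z) \<in> J" if f: "poly_map f" "f \<notin> J" for f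
  proof (rule ccontr)
    assume n: "\<nexists>g. poly_map g \<and> (\<lambda>z. 1 - g z * f z) \<in> J"
    \<comment> \<open>The ideal generated by \<open>J\<close> and \<open>f\<close>; without an
      inverse of \<open>f\<close> modulo \<open>J\<close> it would be proper and strictly larger
      than \<open>J\<close>.\<close>
    let ?J = "{h. \<exists>u\<in>J. \<exists>g. poly_map g \<and> h = (\<lambda>z. u z + g z * f z)}"
    have in_J: "h \<in> ?J" if "u \<in> J" "poly_map g" "\<And>z. h z = u z + g z * f z" for h u g
      using that by blast
    have "poly_ideal ?J"
    proof
      fix h assume "h \<in> ?J"
      then show "poly_map h" using f poly by (auto intro: poly_map.intros)
    next
      show "(\<lambda>_. 0) \<in> ?J" by (rule in_J[OF zero poly_map.const[of 0]]) simp
    next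
      fix h h' assume "h \<in> ?J" "h' \<in> ?J"
      then obtain u g u' g' where "u \<in> J" "poly_map g" "h = (\<lambda>z. u z + g z * f z)"
        "u' \<in> J" "poly_map g'" "h' = (\<lambda>z. u' z + g' z * f z)" by blast
      then show "(\<lambda>z. h z + h' z) \<in> ?J"
        by (intro in_J[OF add poly_map.add, of u u' g g']) (auto simp: algebra_simps)
    next
      fix h and q :: "('i \<Rightarrow> 'k) \<Rightarrow> 'k" assume "h \<in> ?J" and q: "poly_map q"
      then obtain u g where "u \<in> J" "poly_map g" "h = (\<lambda>z. u z + g z * f z)" by blast
      then show "(\<lambda>z. q z * h z) \<in> ?J"
        by (intro in_J[OF mult poly_map.mult, of u q q g]) (auto simp: algebra_simps q)
    next
      show "(\<lambda>_. 1) \<notin> ?J"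
      proof
        assume "(\<lambda>_. 1) \<in> ?J"
        then obtain u g where ug: "u \<in> J" "poly_map g" "(\<lambda>_. 1) = (\<lambda>z. u z + g z * f z)" by blast
        then have "u = (\<lambda>z. 1 - g z * f z)" by (auto simp: fun_eq_iff eq_diff_eq)
        then show False using n ug by blast
      qed
    qed
    moreover have "J \<subseteq> ?J" using in_J[OF _ poly_map.const[of 0]] by auto
    moreover have "f \<in> ?J" by (rule in_J[OF zero poly_map.const[of 1]]) simp
    ultimately show False using max f by blast
  qed
  have prime: "f \<in> J \<or> h \<in> J" if fh: "(\<lambda>z. f z * h z) \<in> J" "poly_map f" "poly_map h" for f h
  proof (cases "f \<in> J")
    case False
    then obtain g where g: "poly_map g" "(\<lambda>z. 1 - g z * f z) \<in> J" using inv fh(2) by blast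
    have "(\<lambda>z. h z * (1 - g z * f z) + g z * (f z * h z)) \<in> J"
      by (intro add mult g fh)
    then show ?thesis by (simp add: algebra_simps)
  qed simp
  have lin: "poly_map (\<lambda>z. z i - a)" for a :: 'k
    by (intro poly_map_diff poly_map.intros)
  \<comment> \<open>\<open>g a\<close> is an inverse of \<open>z i - a\<close> modulo
    \<open>J\<close>, one for each of the uncountably many constants \<open>a\<close>.\<close>
  obtain g where g: "\<And>a. poly_map (g a)" "\<And>a. (\<lambda>z. 1 - g a z * (z i - a)) \<in> J"
    using inv[OF lin] no by metis
  have cnt: "countable (range (\<lambda>l (z :: 'i \<Rightarrow> 'k). prod_list (map z l)))"
    using countable_lists[OF I] by (intro countable_image) (simp add: lists_UNIV)
  obtain S c where S: "finite S" "\<And>x. (\<Sum>a\<in>S. c a * g a x) = 0" "\<exists>a\<in>S. c a \<noteq> 0"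
    using uncountable_family_dependent[OF K cnt, of g] poly_map_in_span[OF g(1)] by blast
  \<comment> \<open>The numerator of \<open>\<Sum>a\<in>S. c a / (x - a)\<close>: the linear
    relation between the inverses \<open>g a\<close> with denominators cleared.\<close>
  define q where "q = (\<Sum>a\<in>S. smult (c a) (\<Prod>b\<in>S-{a}. [:- b, 1:]))"
  have q: "poly q x = (\<Sum>a\<in>S. c a * (\<Prod>b\<in>S-{a}. x - b))" for x
    unfolding q_def by (simp add: poly_sum poly_prod)
  have "q \<noteq> 0"
  proof -
    obtain a where a: "a \<in> S" "c a \<noteq> 0" using S by blast
    \<comment> \<open>At the node \<open>a\<close> every other summand contains the factor
      \<open>a - a\<close>, so the nonzero coefficient \<open>c a\<close> survives in a nonzero
      value.\<close>
    have "poly q a = (\<Sum>s\<in>S. if s = a then c a * (\<Prod>b\<in>S-{a}. a - b) else 0)"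
      unfolding q using S(1) a by (intro sum.cong) auto
    also have "\<dots> \<noteq> 0" using S(1) a by auto
    finally show ?thesis by auto
  qed
  moreover have "(\<lambda>z. poly q (z i)) \<in> J"
  proof -
    \<comment> \<open>The first term lies in \<open>J\<close> because
      \<open>1 - g a z * (z i - a)\<close> does; the second terms share the factor
      \<open>\<Prod>b\<in>S. z i - b\<close> and cancel in the sum by the linear relation.\<close>
    have e: "c a * (\<Prod>b\<in>S-{a}. z i - b) =
        c a * (\<Prod>b\<in>S-{a}. z i - b) * (1 - g a z * (z i - a)) + c a * g a z * (\<Prod>b\<in>S. z i - b)"
      if "a \<in> S" for a z
      unfolding prod.remove[OF S(1) that, of "\<lambda>b. z i - b"] by (simp add: algebra_simps)
    have "poly q (z i) = (\<Sum>a\<in>S. c a * (\<Prod>b\<in>S-{a}. z i - b) * (1 - g a z * (z i - a)))" for z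
      unfolding q using S(2)[of z]
      by (subst sum.cong[OF refl e]) (auto simp: sum.distrib sum_distrib_right[symmetric])
    moreover have "(\<lambda>z. \<Sum>a\<in>S. c a * (\<Prod>b\<in>S-{a}. z i - b) * (1 - g a z * (z i - a))) \<in> J"
      using S(1) by (intro sum mult g poly_map.mult poly_map.const poly_map_prod lin) auto
    ultimately show ?thesis by presburger
  qed
  ultimately show False
  \<comment> \<open>Roots are split off one at a time: \<open>J\<close> is prime and contains no
    \<open>z i - r\<close>, so the cofactor stays in \<open>J\<close> until a nonzero constant is
    reached.\<close>
  proof (induction "degree q" arbitrary: q)
    case 0
    then obtain d where "q = [:d:]" using degree_eq_zeroE by metis
    then show ?case using 0 const[of d] by simp
  next
    case (Suc n)
    then obtain r where "poly q r = 0" using alg_closed_imp_poly_has_root[of q] by auto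
    then obtain q' where q': "q = [:- r, 1:] * q'" by (auto simp: poly_eq_0_iff_dvd)
    with Suc.prems have "q' \<noteq> 0" by auto
    have pq: "poly_map (\<lambda>z. poly q' (z i))"
      by (induction q') (simp_all add: poly_map.intros)
    have "(\<lambda>z. (z i - r) * poly q' (z i)) \<in> J" using Suc.prems(2) by (simp add: q' algebra_simps)
    then have "(\<lambda>z. poly q' (z i)) \<in> J" using prime[OF _ lin pq] no by blast
    moreover have "n = degree q'" using Suc.hyps(2) degree_mult_eq[of "[:- r, 1:]" q'] \<open>q' \<noteq> 0\<close> by (simp add: q')
    ultimately show ?case using Suc.hyps(1) \<open>q' \<noteq> 0\<close> by blast
  qed
qed

text \<open>A maximal ideal containing the given polynomials contains \<open>z i - a i\<close> for every variable \<open>i\<close>;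
  the point \<open>a\<close> is a common zero.\<close>

theorem countable_nullstellensatz:
  fixes P :: "(('i \<Rightarrow> 'k::alg_closed_field) \<Rightarrow> 'k) set"
  assumes K: "uncountable (UNIV :: 'k set)" and I: "countable (UNIV :: 'i set)"
    and P: "\<And>p. p \<in> P \<Longrightarrow> poly_map p"
    and fip: "\<And>F. finite F \<Longrightarrow> F \<subseteq> P \<Longrightarrow> \<exists>z. \<forall>p\<in>F. p z = 0"
  shows "\<exists>z. \<forall>p\<in>P. p z = 0"
proof -
  let ?\<A> = "{J. poly_ideal J \<and> P \<subseteq> J}"
  \<comment> \<open>Vanishing on the common zeros of finitely many members of \<open>P\<close>
    replaces membership in the ideal generated by \<open>P\<close>: closure under the operations is
    evident, and \<open>fip\<close> says exactly that \<open>1\<close> is missing.\<close>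
  let ?J = "{f. poly_map f \<and> (\<exists>F\<subseteq>P. finite F \<and> (\<forall>z. (\<forall>p\<in>F. p z = 0) \<longrightarrow> f z = 0))}"
  have "poly_ideal ?J"
  proof
    show "(\<lambda>_. 0) \<in> ?J" by (auto intro: poly_map.const)
  next
    fix f g assume "f \<in> ?J" "g \<in> ?J"
    then obtain F G where "poly_map f" "F \<subseteq> P" "finite F" "\<forall>z. (\<forall>p\<in>F. p z = 0) \<longrightarrow> f z = 0"
      "poly_map g" "G \<subseteq> P" "finite G" "\<forall>z. (\<forall>p\<in>G. p z = 0) \<longrightarrow> g z = 0" by blast
    then show "(\<lambda>z. f z + g z) \<in> ?J"
      by (auto intro!: poly_map.add exI[of _ "F \<union> G"])
  next
    show "(\<lambda>_. 1) \<notin> ?J" using fip by auto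
  qed (auto intro: poly_map.mult)
  moreover have "P \<subseteq> ?J" using P by (auto intro!: exI[of _ "{_}"])
  ultimately have "?\<A> \<noteq> {}" by blast
  moreover have "\<Union>\<C> \<in> ?\<A>" if "\<C> \<noteq> {}" "subset.chain ?\<A> \<C>" for \<C>
  proof -
    have C: "poly_ideal J" "P \<subseteq> J" if "J \<in> \<C>" for J
      using \<open>subset.chain ?\<A> \<C>\<close> that by (auto simp: subset_chain_def)
    have "poly_ideal (\<Union>\<C>)"
    proof
      fix f g assume "f \<in> \<Union>\<C>" "g \<in> \<Union>\<C>"
      then obtain J where "J \<in> \<C>" "f \<in> J" "g \<in> J"
        using \<open>subset.chain ?\<A> \<C>\<close> unfolding subset_chain_def by blast
      then show "(\<lambda>z. f z + g z) \<in> \<Union>\<C>" using poly_ideal.add[OF C(1)] by blast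
    next
      show "(\<lambda>_. 0) \<in> \<Union>\<C>" using \<open>\<C> \<noteq> {}\<close> poly_ideal.zero[OF C(1)] by blast
    qed (use poly_ideal.poly[OF C(1)] poly_ideal.mult[OF C(1)] poly_ideal.proper[OF C(1)] in blast)+
    then show ?thesis using \<open>\<C> \<noteq> {}\<close> C(2) by blast
  qed
  ultimately obtain J where J: "poly_ideal J" "P \<subseteq> J"
      and max: "\<And>J'. poly_ideal J' \<Longrightarrow> J \<subseteq> J' \<Longrightarrow> J' = J"
    using subset_Zorn_nonempty[of ?\<A>] by auto
  interpret poly_ideal J by (rule J)
  obtain a where a: "\<And>i. (\<lambda>z. z i - a i) \<in> J"
    using maximal_poly_ideal_coordinate[OF K I J(1) max] by metis
  \<comment> \<open>Reduction modulo \<open>J\<close> is evaluation at \<open>a\<close>.\<close>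
  have "(\<lambda>z. p z - p a) \<in> J" if "poly_map p" for p
    using that
  proof induction
    case (const c)
    show ?case using zero by simp
  next
    case (coord i)
    show ?case by (rule a)
  next
    case (add p q)
    then show ?case using poly_ideal.add[OF J(1) add.IH] by (simp add: algebra_simps)
  next
    case (mult p q)
    have "(\<lambda>z. q z * (p z - p a) + p a * (q z - q a)) \<in> J"
      by (intro poly_ideal.add[OF J(1)] poly_ideal.mult[OF J(1)] mult poly_map.const)
    then show ?case by (simp add: algebra_simps)
  qed
  have "p a = 0" if p: "p \<in> P" for p
  proof -
    \<comment> \<open>The combination is the constant \<open>p a\<close>, and a proper ideal
      contains no nonzero constant.\<close>
    have "(\<lambda>z. p z + (- 1) * (p z - p a)) \<in> J"
      using p J(2) P \<open>poly_map p \<Longrightarrow> (\<lambda>z. p z - p a) \<in> J\<close>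
      by (intro poly_ideal.add[OF J(1)] poly_ideal.mult[OF J(1)] poly_map.const) auto
    then show ?thesis using const[of "p a"] by simp
  qed
  then show ?thesis by blast
qed

section \<open>Algebraic sets in countably many variables\<close>

definition poly_open :: "('i \<Rightarrow> 'k::field) set \<Rightarrow> ('i \<Rightarrow> 'k) set \<Rightarrow> bool" where
  "poly_open B W \<longleftrightarrow> W \<subseteq> B \<and> (\<forall>z\<in>W. \<exists>q. poly_map q \<and> q z \<noteq> 0 \<and> (\<forall>y\<in>B. q y \<noteq> 0 \<longrightarrow> y \<in> W))"

text \<open>A subset of a possibly infinite-dimensional affine space becomes a space with functions,
  so that morphisms from it into \<open>X\<close> and its fibered powers make sense. The denominator
  \<open>q\<close> itself cuts out the neighbourhood on which the quotient is valid.\<close>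

definition algebraic_space :: "('i \<Rightarrow> 'k::field) set \<Rightarrow> ('i \<Rightarrow> 'k, 'k) function_space" where
  "algebraic_space B =
     \<lparr>zariski = topology (poly_open B),
      regular = (\<lambda>W f. \<forall>z\<in>W. \<exists>p q. poly_map p \<and> poly_map q \<and> q z \<noteq> 0 \<and>
        (\<forall>y\<in>B. q y \<noteq> 0 \<longrightarrow> y \<in> W \<and> f y = p y / q y))\<rparr>"

text \<open>Zariski closedness of \<open>B\<close> in the full affine space, phrased as separation
  of outside points from \<open>B\<close>.\<close>

definition algebraic_set :: "('i \<Rightarrow> 'k::field) set \<Rightarrow> bool" where
  "algebraic_set B \<longleftrightarrow> (\<forall>z. z \<notin> B \<longrightarrow> (\<exists>q. poly_map q \<and> q z \<noteq> 0 \<and> (\<forall>y\<in>B. q y = 0)))"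

lemma openin_algebraic_space: "openin (zariski (algebraic_space B)) = poly_open B"
proof -
  have "istopology (poly_open B)"
    unfolding istopology_def
  proof (intro conjI allI impI)
    fix S T assume ST: "poly_open B S" "poly_open B T"
    show "poly_open B (S \<inter> T)"
      unfolding poly_open_def
    proof (intro conjI ballI)
      fix z assume "z \<in> S \<inter> T"
      then obtain p q where "poly_map p" "p z \<noteq> 0" "\<forall>y\<in>B. p y \<noteq> 0 \<longrightarrow> y \<in> S"
        "poly_map q" "q z \<noteq> 0" "\<forall>y\<in>B. q y \<noteq> 0 \<longrightarrow> y \<in> T"
        using ST unfolding poly_open_def by blast
      then show "\<exists>q. poly_map q \<and> q z \<noteq> 0 \<and> (\<forall>y\<in>B. q y \<noteq> 0 \<longrightarrow> y \<in> S \<inter> T)"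
        by (intro exI[of _ "\<lambda>y. p y * q y"]) (auto simp: poly_map.mult)
    qed (use ST in \<open>auto simp: poly_open_def\<close>)
  next
    fix \<K> assume "\<forall>K\<in>\<K>. poly_open B K"
    then have K: "poly_open B K" if "K \<in> \<K>" for K using that by blast
    show "poly_open B (\<Union>\<K>)"
      unfolding poly_open_def
    proof (intro conjI ballI)
      show "\<Union>\<K> \<subseteq> B" using K unfolding poly_open_def by blast
    next
      fix z assume "z \<in> \<Union>\<K>"
      then obtain L where L: "L \<in> \<K>" "z \<in> L" by blast
      then obtain q where "poly_map q" "q z \<noteq> 0" "\<forall>y\<in>B. q y \<noteq> 0 \<longrightarrow> y \<in> L"
        using K[OF L(1)] unfolding poly_open_def by blast
      then show "\<exists>q. poly_map q \<and> q z \<noteq> 0 \<and> (\<forall>y\<in>B. q y \<noteq> 0 \<longrightarrow> y \<in> \<Union>\<K>)" using L by blast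
    qed
  qed
  then show ?thesis by (simp add: algebraic_space_def topology_inverse')
qed

lemma points_algebraic_space [simp]: "points (algebraic_space B) = B"
proof (rule subset_antisym)
  show "points (algebraic_space B) \<subseteq> B"
    unfolding topspace_def openin_algebraic_space poly_open_def by blast
  have "poly_open B B"
    unfolding poly_open_def using poly_map.const[of 1] by (auto intro!: exI[of _ "\<lambda>_. 1"])
  then show "B \<subseteq> points (algebraic_space B)"
    by (intro openin_subset) (simp add: openin_algebraic_space)
qed

lemma regular_algebraic_spaceE:
  assumes "regular (algebraic_space B) W f" "z \<in> W"
  obtains p q where "poly_map p" "poly_map q" "q z \<noteq> 0"
    "\<forall>y\<in>B. q y \<noteq> 0 \<longrightarrow> y \<in> W \<and> f y = p y / q y"
  using assms unfolding algebraic_space_def by auto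

lemma space_algebraic_space: "space_with_functions (algebraic_space B)"
proof -
  let ?Y = "algebraic_space B"
  have regI: "regular ?Y W f" if "\<And>z. z \<in> W \<Longrightarrow> \<exists>p q. poly_map p \<and> poly_map q \<and> q z \<noteq> 0 \<and>
      (\<forall>y\<in>B. q y \<noteq> 0 \<longrightarrow> y \<in> W \<and> f y = p y / q y)" for W f
    using that by (auto simp: algebraic_space_def)
  have opE: "\<exists>q. poly_map q \<and> q z \<noteq> 0 \<and> (\<forall>y\<in>B. q y \<noteq> 0 \<longrightarrow> y \<in> W)"
    if "openin (zariski ?Y) W" "z \<in> W" for W z
    using that by (auto simp: openin_algebraic_space poly_open_def)
  have opB: "W \<subseteq> B" if "openin (zariski ?Y) W" for W
    using that by (auto simp: openin_algebraic_space poly_open_def)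
  have local: "regular ?Y W f"
    if "\<And>z. z \<in> W \<Longrightarrow> \<exists>V g. openin (zariski ?Y) V \<and> z \<in> V \<and> V \<subseteq> W \<and> regular ?Y U g \<and> V \<subseteq> U \<and>
      (\<forall>y\<in>V. f y = g y)" for W U f
  proof (rule regI)
    fix z assume "z \<in> W"
    from that[OF this] obtain V g where V: "openin (zariski ?Y) V" "z \<in> V" "V \<subseteq> W" "V \<subseteq> U"
      and g: "regular ?Y U g" "\<forall>y\<in>V. f y = g y" by blast
    obtain h where h: "poly_map h" "h z \<noteq> 0" "\<forall>y\<in>B. h y \<noteq> 0 \<longrightarrow> y \<in> V" using opE[OF V(1,2)] by blast
    obtain p q where pq: "poly_map p" "poly_map q" "q z \<noteq> 0"
        "\<forall>y\<in>B. q y \<noteq> 0 \<longrightarrow> y \<in> U \<and> g y = p y / q y"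
      by (rule regular_algebraic_spaceE[OF g(1), of z]) (use V in auto)
    \<comment> \<open>Multiplying numerator and denominator by \<open>h\<close> leaves the quotient
      alone and shrinks its domain into \<open>V\<close>, where \<open>f\<close> and
      \<open>g\<close> agree.\<close>
    show "\<exists>p q. poly_map p \<and> poly_map q \<and> q z \<noteq> 0 \<and> (\<forall>y\<in>B. q y \<noteq> 0 \<longrightarrow> y \<in> W \<and> f y = p y / q y)"
      by (rule exI[of _ "\<lambda>y. p y * h y"], rule exI[of _ "\<lambda>y. q y * h y"])
        (use h pq g(2) V(3) in \<open>auto simp: poly_map.mult\<close>)
  qed
  have inv: "openin (zariski ?Y) {x \<in> U. f x \<noteq> 0} \<and> regular ?Y {x \<in> U. f x \<noteq> 0} (\<lambda>x. inverse (f x))"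
    if U: "openin (zariski ?Y) U" and f: "regular ?Y U f" for U f
  proof -
    have "\<exists>p q. poly_map p \<and> poly_map q \<and> q z \<noteq> 0 \<and>
        (\<forall>y\<in>B. q y \<noteq> 0 \<longrightarrow> y \<in> {x \<in> U. f x \<noteq> 0} \<and> inverse (f y) = p y / q y)"
      if z: "z \<in> {x \<in> U. f x \<noteq> 0}" for z
    proof -
      obtain p q where pq: "poly_map p" "poly_map q" "q z \<noteq> 0"
        "\<forall>y\<in>B. q y \<noteq> 0 \<longrightarrow> y \<in> U \<and> f y = p y / q y"
        by (rule regular_algebraic_spaceE[OF f, of z]) (use z in auto)
      have "z \<in> B" using z opB[OF U] by auto
      then have "p z \<noteq> 0" using z pq(3,4) by auto
      \<comment> \<open>\<open>q y * q y / (p y * q y)\<close> instead of \<open>q y / p y\<close>: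
        the denominator must also vanish where \<open>q\<close> does, since nothing is known about
        \<open>f\<close> there.\<close>
      then show ?thesis
        by (intro exI[of _ "\<lambda>y. q y * q y"] exI[of _ "\<lambda>y. p y * q y"])
          (use pq in \<open>auto simp: poly_map.mult\<close>)
    qed
    note k = this
    have "regular ?Y {x \<in> U. f x \<noteq> 0} (\<lambda>x. inverse (f x))" by (rule regI[OF k])
    moreover have "openin (zariski ?Y) {x \<in> U. f x \<noteq> 0}"
      unfolding openin_algebraic_space poly_open_def
    proof (intro conjI ballI)
      fix z assume "z \<in> {x \<in> U. f x \<noteq> 0}"
      from k[OF this] show "\<exists>q. poly_map q \<and> q z \<noteq> 0 \<and> (\<forall>y\<in>B. q y \<noteq> 0 \<longrightarrow> y \<in> {x \<in> U. f x \<noteq> 0})"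
        by blast
    qed (use opB[OF U] in blast)
    ultimately show ?thesis by blast
  qed
  show ?thesis
    unfolding space_with_functions_def
  proof (intro conjI allI impI)
    fix U V f assume a: "openin (zariski ?Y) U \<and> openin (zariski ?Y) V \<and> V \<subseteq> U \<and> regular ?Y U f"
    show "regular ?Y V f" by (rule local[of V U]) (use a in blast)
  next
    fix U f assume a: "openin (zariski ?Y) U \<and> (\<forall>x\<in>U. \<exists>V g. openin (zariski ?Y) V \<and> x \<in> V \<and> V \<subseteq> U \<and>
      regular ?Y V g \<and> (\<forall>y\<in>V. f y = g y))"
    show "regular ?Y U f"
    proof (rule regI)
      fix z assume z: "z \<in> U"
      then obtain V g where V: "z \<in> V" "V \<subseteq> U" "regular ?Y V g" "\<forall>y\<in>V. f y = g y" using a by blast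
      obtain p q where "poly_map p" "poly_map q" "q z \<noteq> 0"
        "\<forall>y\<in>B. q y \<noteq> 0 \<longrightarrow> y \<in> V \<and> g y = p y / q y"
        by (rule regular_algebraic_spaceE[OF V(3,1)])
      then show "\<exists>p q. poly_map p \<and> poly_map q \<and> q z \<noteq> 0 \<and> (\<forall>y\<in>B. q y \<noteq> 0 \<longrightarrow> y \<in> U \<and> f y = p y / q y)"
        using V by (intro exI[of _ p] exI[of _ q]) auto
    qed
  next
    fix U a assume U: "openin (zariski ?Y) U"
    show "regular ?Y U (\<lambda>_. a)"
    proof (rule regI)
      fix z assume "z \<in> U"
      then obtain q where "poly_map q" "q z \<noteq> 0" "\<forall>y\<in>B. q y \<noteq> 0 \<longrightarrow> y \<in> U" using opE[OF U] by blast
      \<comment> \<open>The constant is written with the denominator \<open>q\<close>, whose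
        non-vanishing set in \<open>B\<close> lies in \<open>U\<close>.\<close>
      then show "\<exists>p q. poly_map p \<and> poly_map q \<and> q z \<noteq> 0 \<and> (\<forall>y\<in>B. q y \<noteq> 0 \<longrightarrow> y \<in> U \<and> a = p y / q y)"
        by (intro exI[of _ "\<lambda>y. a * q y"] exI[of _ q]) (auto simp: poly_map.intros)
    qed
  next
    fix U f g assume fg: "regular ?Y U f \<and> regular ?Y U g"
    have key: "\<exists>p q p' q'. poly_map p \<and> poly_map q \<and> poly_map p' \<and> poly_map q' \<and> q z \<noteq> 0 \<and> q' z \<noteq> 0 \<and>
        (\<forall>y\<in>B. q y \<noteq> 0 \<longrightarrow> y \<in> U \<and> f y = p y / q y) \<and> (\<forall>y\<in>B. q' y \<noteq> 0 \<longrightarrow> y \<in> U \<and> g y = p' y / q' y)"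
      if "z \<in> U" for z
      using regular_algebraic_spaceE[OF conjunct1[OF fg] that] regular_algebraic_spaceE[OF conjunct2[OF fg] that]
      by metis
    show "regular ?Y U (\<lambda>x. f x + g x)"
    proof (rule regI)
      fix z assume "z \<in> U"
      from key[OF this] obtain p q p' q' where k: "poly_map p" "poly_map q" "poly_map p'" "poly_map q'"
        "q z \<noteq> 0" "q' z \<noteq> 0" "\<forall>y\<in>B. q y \<noteq> 0 \<longrightarrow> y \<in> U \<and> f y = p y / q y"
        "\<forall>y\<in>B. q' y \<noteq> 0 \<longrightarrow> y \<in> U \<and> g y = p' y / q' y" by blast
      then show "\<exists>p q. poly_map p \<and> poly_map q \<and> q z \<noteq> 0 \<and>
          (\<forall>y\<in>B. q y \<noteq> 0 \<longrightarrow> y \<in> U \<and> f y + g y = p y / q y)"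
        by (intro exI[of _ "\<lambda>y. p y * q' y + p' y * q y"] exI[of _ "\<lambda>y. q y * q' y"])
          (auto simp: poly_map.add poly_map.mult add_frac_eq)
    qed
    show "regular ?Y U (\<lambda>x. f x * g x)"
    proof (rule regI)
      fix z assume "z \<in> U"
      from key[OF this] obtain p q p' q' where k: "poly_map p" "poly_map q" "poly_map p'" "poly_map q'"
        "q z \<noteq> 0" "q' z \<noteq> 0" "\<forall>y\<in>B. q y \<noteq> 0 \<longrightarrow> y \<in> U \<and> f y = p y / q y"
        "\<forall>y\<in>B. q' y \<noteq> 0 \<longrightarrow> y \<in> U \<and> g y = p' y / q' y" by blast
      then show "\<exists>p q. poly_map p \<and> poly_map q \<and> q z \<noteq> 0 \<and>
          (\<forall>y\<in>B. q y \<noteq> 0 \<longrightarrow> y \<in> U \<and> f y * g y = p y / q y)"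
        by (intro exI[of _ "\<lambda>y. p y * p' y"] exI[of _ "\<lambda>y. q y * q' y"])
          (auto simp: poly_map.mult)
    qed
  next
    fix U f assume "openin (zariski ?Y) U" "regular ?Y U f"
    from inv[OF this] show "openin (zariski ?Y) {x \<in> U. f x \<noteq> 0}"
      "regular ?Y {x \<in> U. f x \<noteq> 0} (\<lambda>x. inverse (f x))" by blast+
  qed
qed

text \<open>This replaces the nonemptiness of inverse limits of constructible sets over uncountable fields.\<close>

lemma compact_algebraic_space:
  fixes B :: "('i \<Rightarrow> 'k::alg_closed_field) set"
  assumes K: "uncountable (UNIV :: 'k set)" and I: "countable (UNIV :: 'i set)" and B: "algebraic_set B"
  shows "compact_space (zariski (algebraic_space B))"
  unfolding compact_space_fip
proof (intro allI impI, elim conjE)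
  fix \<C> assume closed: "\<forall>C\<in>\<C>. closedin (zariski (algebraic_space B)) C"
    and fip: "\<forall>\<F>. finite \<F> \<and> \<F> \<subseteq> \<C> \<longrightarrow> \<Inter>\<F> \<noteq> {}"
  \<comment> \<open>The union of the vanishing ideals of the members of \<open>\<C>\<close>; a
    finite part of it vanishes on a finite intersection.\<close>
  let ?P = "{p. poly_map p \<and> (\<exists>C\<in>\<C>. \<forall>y\<in>C. p y = 0)}"
  have "\<exists>z. \<forall>p\<in>?P. p z = 0"
  proof (rule countable_nullstellensatz[OF K I])
    fix F assume F: "finite F" "F \<subseteq> ?P"
    then have "\<forall>p\<in>F. \<exists>C. C \<in> \<C> \<and> (\<forall>y\<in>C. p y = 0)" by blast
    then obtain C where C: "\<And>p. p \<in> F \<Longrightarrow> C p \<in> \<C> \<and> (\<forall>y\<in>C p. p y = 0)" by metis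
    then have "\<Inter>(C ` F) \<noteq> {}" using F(1) by (intro fip[rule_format]) auto
    then show "\<exists>z. \<forall>p\<in>F. p z = 0" using C by blast
  qed blast
  then obtain z where z: "\<And>p. p \<in> ?P \<Longrightarrow> p z = 0" by blast
  have "z \<in> C" if C: "C \<in> \<C>" for C
  proof (rule ccontr)
    assume "z \<notin> C"
    have cl: "C \<subseteq> B" "poly_open B (B - C)"
      using closed C by (auto simp: closedin_def openin_algebraic_space)
    have "\<exists>q. poly_map q \<and> q z \<noteq> 0 \<and> (\<forall>y\<in>C. q y = 0)"
    \<comment> \<open>The Nullstellensatz places \<open>z\<close> only in the ambient space; a point
      outside \<open>B\<close> is excluded because \<open>B\<close> is algebraic.\<close>
    proof (cases "z \<in> B")
      case True
      then have "z \<in> B - C" using \<open>z \<notin> C\<close> by blast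
      then obtain q where "poly_map q" "q z \<noteq> 0" "\<forall>y\<in>B. q y \<noteq> 0 \<longrightarrow> y \<in> B - C"
        using cl(2) unfolding poly_open_def by blast
      then show ?thesis using cl(1) by blast
    next
      case False
      then obtain q where "poly_map q" "q z \<noteq> 0" "\<forall>y\<in>B. q y = 0"
        using B unfolding algebraic_set_def by metis
      then show ?thesis using cl(1) by blast
    qed
    then obtain q where "poly_map q" "q z \<noteq> 0" "\<forall>y\<in>C. q y = 0" by blast
    then show False using z[of q] C by blast
  qed
  then show "\<Inter>\<C> \<noteq> {}" by blast
qed

section \<open>Morphisms of spaces with functions\<close>

lemma morphism_from_algebraic_spaceI:
  assumes X: "space_with_functions X" and \<psi>: "\<psi> \<in> B \<rightarrow> points X"
    and loc: "\<And>U f z. openin (zariski X) U \<Longrightarrow> regular X U f \<Longrightarrow> z \<in> B \<Longrightarrow> \<psi> z \<in> U \<Longrightarrow>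
      \<exists>p q. poly_map p \<and> poly_map q \<and> q z \<noteq> 0 \<and> (\<forall>y\<in>B. q y \<noteq> 0 \<longrightarrow> \<psi> y \<in> U \<and> f (\<psi> y) = p y / q y)"
  shows "variety_morphism (algebraic_space B) X \<psi>"
  unfolding variety_morphism_def continuous_map_def
proof (intro conjI allI impI)
  show "\<psi> \<in> points (algebraic_space B) \<rightarrow> points X" using \<psi> by simp
next
  fix U assume U: "openin (zariski X) U"
  \<comment> \<open>Applied to the zero function, \<open>loc\<close> yields openness of the preimage
    of \<open>U\<close>.\<close>
  then have "regular X U (\<lambda>_. 0)" using X unfolding space_with_functions_def by blast
  from loc[OF U this] show "openin (zariski (algebraic_space B)) {x \<in> points (algebraic_space B). \<psi> x \<in> U}"
    unfolding openin_algebraic_space poly_open_def points_algebraic_space by blast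
next
  fix V h assume "openin (zariski X) V \<and> regular X V h"
  then show "regular (algebraic_space B) {x \<in> points (algebraic_space B). \<psi> x \<in> V} (h \<circ> \<psi>)"
    using loc[of V h] by (simp add: algebraic_space_def openin_algebraic_space[unfolded algebraic_space_def, simplified]
      points_algebraic_space[unfolded algebraic_space_def, simplified])
qed

lemma variety_morphism_compose:
  assumes "variety_morphism X Y f" "variety_morphism Y Z g"
  shows "variety_morphism X Z (g \<circ> f)"
  unfolding variety_morphism_def
proof (intro conjI allI impI)
  show "continuous_map (zariski X) (zariski Z) (g \<circ> f)"
    by (rule continuous_map_compose) (use assms in \<open>auto simp: variety_morphism_def\<close>)
next
  fix V h assume V: "openin (zariski Z) V \<and> regular Z V h"
  let ?W = "{y \<in> points Y. g y \<in> V}"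
  have "openin (zariski Y) ?W" "regular Y ?W (h \<circ> g)"
    using assms(2) V unfolding variety_morphism_def continuous_map_def by blast+
  then have "regular X {x \<in> points X. f x \<in> ?W} (h \<circ> g \<circ> f)"
    using assms(1) unfolding variety_morphism_def by blast
  moreover have "{x \<in> points X. f x \<in> ?W} = {x \<in> points X. (g \<circ> f) x \<in> V}"
    using assms(1) unfolding variety_morphism_def continuous_map_def by auto
  ultimately show "regular X {x \<in> points X. (g \<circ> f) x \<in> V} (h \<circ> (g \<circ> f))" by (simp add: o_assoc)
qed

text \<open>By the gluing axiom regularity only sees values at points. This matters because a local
  defining map describes a cellular automaton on configurations only.\<close>

lemma variety_morphism_cong:
  assumes Y: "space_with_functions Y" and f: "variety_morphism Y X f"
    and eq: "\<And>y. y \<in> points Y \<Longrightarrow> f y = g y"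
  shows "variety_morphism Y X g"
  unfolding variety_morphism_def
proof (intro conjI allI impI)
  show "continuous_map (zariski Y) (zariski X) g"
    using f eq continuous_map_eq unfolding variety_morphism_def by blast
next
  fix V h assume V: "openin (zariski X) V \<and> regular X V h"
  let ?W = "{y \<in> points Y. f y \<in> V}"
  have W: "openin (zariski Y) ?W" "regular Y ?W (h \<circ> f)"
    using f V unfolding variety_morphism_def continuous_map_def by blast+
  have "regular Y ?W (h \<circ> g)"
    by (rule Y[unfolded space_with_functions_def, THEN conjunct2, THEN conjunct1, rule_format])
      (use W eq in \<open>fastforce intro!: exI[of _ ?W]\<close>)
  moreover have "?W = {y \<in> points Y. g y \<in> V}" using eq by auto
  ultimately show "regular Y {y \<in> points Y. g y \<in> V} (h \<circ> g)" by simp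
qed

section \<open>Configurations of points of a variety\<close>

lemma poly_map_poly_function:
  "poly_function n p \<Longrightarrow> poly_map (\<lambda>z. p (restrict (\<lambda>k. z (t k)) {..<n}))"
  by (induction rule: poly_function.induct) (simp_all add: poly_map.intros)

lemma variety_morphism_points: "variety_morphism X Y f \<Longrightarrow> x \<in> points X \<Longrightarrow> f x \<in> points Y"
  by (auto simp: variety_morphism_def continuous_map_def)

lemma zariski_affine_separation:
  assumes "closedin (zariski_affine n) V" "v \<in> affine_space n" "v \<notin> V"
  shows "\<exists>p. poly_function n p \<and> p v \<noteq> 0 \<and> (\<forall>y\<in>V. p y = 0)"
proof -
  have V: "V \<subseteq> affine_space n" "openin (zariski_affine n) (affine_space n - V)"
    using assms(1) by (auto simp: closedin_def topspace_zariski_affine)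
  then obtain P where P: "\<forall>p\<in>P. poly_function n p" "affine_space n - V = affine_space n - zero_locus n P"
    unfolding openin_zariski_affine by blast
  then have "v \<notin> zero_locus n P" "V \<subseteq> zero_locus n P" using assms V by blast+
  then show ?thesis using P(1) assms(2) unfolding zero_locus_def by blast
qed

text \<open>A quotient representation valid near \<open>v\<close> is made valid on a whole basic set
  \<open>q \<noteq> 0\<close>, the form that \<open>morphism_from_algebraic_spaceI\<close>
  demands.\<close>

lemma regular_in_chart:
  assumes X: "space_with_functions X" and U: "openin (zariski X) U"
    and g: "variety_morphism (affine_set n V) (open_subspace X U) g" and V: "V \<subseteq> affine_space n"
    and W: "openin (zariski X) W" and F: "regular X W F" and v: "v \<in> V" "g v \<in> W"
  obtains p q where "poly_function n p" "poly_function n q" "q v \<noteq> 0"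
    "\<forall>y\<in>V. q y \<noteq> 0 \<longrightarrow> g y \<in> W \<and> F (g y) = p y / q y"
proof -
  have pt: "points (affine_set n V) = V" "points (open_subspace X U) = U"
    using V U openin_subset[OF U]
    by (auto simp: affine_set_def open_subspace_def topspace_zariski_affine)
  have UW: "openin (zariski X) (U \<inter> W)" using U W by blast
  have "regular X (U \<inter> W) F"
    by (rule X[unfolded space_with_functions_def, THEN conjunct1, rule_format, of W]) (use UW W F in auto)
  then have "regular (open_subspace X U) (U \<inter> W) F" "openin (zariski (open_subspace X U)) (U \<inter> W)"
    using W by (auto simp: open_subspace_def openin_subtopology)
  then have reg: "regular (affine_set n V) {x \<in> V. g x \<in> U \<inter> W} (F \<circ> g)"
    using g unfolding variety_morphism_def pt by blast
  have "g v \<in> U" using variety_morphism_points[OF g] v(1) unfolding pt by blast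
  then have "v \<in> {x \<in> V. g x \<in> U \<inter> W}" using v by blast
  from bspec[OF reg[unfolded affine_set_def function_space.simps] this]
  obtain N p q where N: "openin (subtopology (zariski_affine n) V) N \<and> v \<in> N \<and> N \<subseteq> {x \<in> V. g x \<in> U \<inter> W} \<and>
    poly_function n p \<and> poly_function n q \<and> (\<forall>y\<in>N. q y \<noteq> 0 \<and> (F \<circ> g) y = p y / q y)"
    by (elim exE)
  then have pq: "poly_function n p" "poly_function n q" "\<forall>y\<in>N. q y \<noteq> 0 \<and> (F \<circ> g) y = p y / q y"
    and N: "openin (subtopology (zariski_affine n) V) N" "v \<in> N" "N \<subseteq> {x \<in> V. g x \<in> U \<inter> W}"
    by simp_all
  obtain T where T: "openin (zariski_affine n) T" "N = T \<inter> V" using N(1) unfolding openin_subtopology by blast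
  obtain P where P: "\<forall>p\<in>P. poly_function n p" "T = affine_space n - zero_locus n P"
    using T(1) unfolding openin_zariski_affine by blast
  \<comment> \<open>The non-vanishing set of \<open>h\<close> in \<open>V\<close> contains
    \<open>v\<close> and lies inside \<open>N\<close>; expanding the quotient by \<open>h\<close>
    cuts its domain to this set.\<close>
  then obtain h where h: "h \<in> P" "h v \<noteq> 0" using N(2) T(2) unfolding zero_locus_def by blast
  have hN: "y \<in> N" if "y \<in> V" "h y \<noteq> 0" for y
    using that h(1) V unfolding T(2) P(2) zero_locus_def by blast
  show thesis
  proof (rule that[of "\<lambda>y. p y * h y" "\<lambda>y. q y * h y"], goal_cases)
    case 4
    show ?case
    proof (intro ballI impI conjI)
      fix y assume "y \<in> V" "q y * h y \<noteq> 0"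
      then have "y \<in> N" "h y \<noteq> 0" using hN by auto
      then show "g y \<in> W" "F (g y) = (p y * h y) / (q y * h y)" using pq(3) N(3) by auto
    qed
  qed (use pq P(1) h N(2) in \<open>auto simp: poly_function.mult\<close>)
qed

section \<open>Affine charts\<close>

lemma algebraic_variety_charts:
  assumes "algebraic_variety X"
  obtains \<U> n V f g where "finite \<U>" "\<Union>\<U> = points X" "\<forall>U\<in>\<U>. openin (zariski X) U"
    "\<forall>U\<in>\<U>. closedin (zariski_affine (n U)) (V U)"
    "\<forall>U\<in>\<U>. variety_morphism (open_subspace X U) (affine_set (n U) (V U)) (f U)"
    "\<forall>U\<in>\<U>. variety_morphism (affine_set (n U) (V U)) (open_subspace X U) (g U)"
    "\<forall>U\<in>\<U>. \<forall>x\<in>U. f U x \<in> V U \<and> g U (f U x) = x" "\<forall>U\<in>\<U>. \<forall>v\<in>V U. g U v \<in> U"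
proof -
  obtain \<U> where \<U>: "finite \<U>" "\<Union>\<U> = points X" "\<forall>U\<in>\<U>. openin (zariski X) U"
    "\<forall>U\<in>\<U>. \<exists>n V. closedin (zariski_affine n) V \<and> isomorphic_spaces (open_subspace X U) (affine_set n V)"
    using assms unfolding algebraic_variety_def by blast
  have "\<exists>n V f g. closedin (zariski_affine n) V \<and> variety_morphism (open_subspace X U) (affine_set n V) f \<and>
      variety_morphism (affine_set n V) (open_subspace X U) g \<and> (\<forall>x\<in>U. f x \<in> V \<and> g (f x) = x) \<and> (\<forall>v\<in>V. g v \<in> U)"
    if U: "U \<in> \<U>" for U
  proof -
    obtain n V where nV: "closedin (zariski_affine n) V" "isomorphic_spaces (open_subspace X U) (affine_set n V)"
      using \<U>(4) U by blast
    obtain f g where fg: "variety_morphism (open_subspace X U) (affine_set n V) f"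
      "variety_morphism (affine_set n V) (open_subspace X U) g" "\<forall>x\<in>points (open_subspace X U). g (f x) = x"
      using nV(2) unfolding isomorphic_spaces_def by blast
    have pt: "points (affine_set n V) = V" "points (open_subspace X U) = U"
      using closedin_subset[OF nV(1)] openin_subset[of "zariski X" U] \<U>(3) U
      by (auto simp: affine_set_def open_subspace_def)
    have "\<forall>x\<in>U. f x \<in> V \<and> g (f x) = x" "\<forall>v\<in>V. g v \<in> U"
      using fg(3) variety_morphism_points[OF fg(1)] variety_morphism_points[OF fg(2)] unfolding pt by blast+
    then show ?thesis using nV fg by blast
  qed
  then have "\<forall>U\<in>\<U>. \<exists>c. closedin (zariski_affine (fst c)) (fst (snd c)) \<and>
      variety_morphism (open_subspace X U) (affine_set (fst c) (fst (snd c))) (fst (snd (snd c))) \<and>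
      variety_morphism (affine_set (fst c) (fst (snd c))) (open_subspace X U) (snd (snd (snd c))) \<and>
      (\<forall>x\<in>U. (fst (snd (snd c))) x \<in> fst (snd c) \<and> (snd (snd (snd c))) ((fst (snd (snd c))) x) = x) \<and>
      (\<forall>v\<in>fst (snd c). (snd (snd (snd c))) v \<in> U)"
    by (metis fst_conv snd_conv)
  from bchoice[OF this] obtain c where c: "\<forall>U\<in>\<U>. closedin (zariski_affine (fst (c U))) (fst (snd (c U))) \<and>
      variety_morphism (open_subspace X U) (affine_set (fst (c U)) (fst (snd (c U)))) (fst (snd (snd (c U)))) \<and>
      variety_morphism (affine_set (fst (c U)) (fst (snd (c U)))) (open_subspace X U) (snd (snd (snd (c U)))) \<and>
      (\<forall>x\<in>U. (fst (snd (snd (c U)))) x \<in> fst (snd (c U)) \<and> (snd (snd (snd (c U)))) ((fst (snd (snd (c U)))) x) = x) \<and>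
      (\<forall>v\<in>fst (snd (c U)). (snd (snd (snd (c U)))) v \<in> U)" by blast
  show thesis
    by (rule that[of \<U> "\<lambda>U. fst (c U)" "\<lambda>U. fst (snd (c U))" "\<lambda>U. fst (snd (snd (c U)))" "\<lambda>U. snd (snd (snd (c U)))"])
      (use \<U>(1,2,3) c in blast)+
qed

text \<open>Points are closed even without separatedness: a chart missing \<open>a\<close> is a
  neighbourhood avoiding \<open>a\<close>, and inside a chart some affine coordinate tells
  \<open>x\<close> from \<open>a\<close>.\<close>

lemma closedin_point:
  assumes "algebraic_variety X" "a \<in> points X"
  shows "closedin (zariski X) {a}"
proof -
  obtain \<U> n V f g where c: "finite \<U>" "\<Union>\<U> = points X" "\<forall>U\<in>\<U>. openin (zariski X) U"
    "\<forall>U\<in>\<U>. closedin (zariski_affine (n U)) (V U)"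
    "\<forall>U\<in>\<U>. variety_morphism (open_subspace X U) (affine_set (n U) (V U)) (f U)"
    "\<forall>U\<in>\<U>. variety_morphism (affine_set (n U) (V U)) (open_subspace X U) (g U)"
    "\<forall>U\<in>\<U>. \<forall>x\<in>U. f U x \<in> V U \<and> g U (f U x) = x" "\<forall>U\<in>\<U>. \<forall>v\<in>V U. g U v \<in> U"
    using algebraic_variety_charts[OF assms(1)] .
  have "\<exists>N. openin (zariski X) N \<and> x \<in> N \<and> N \<subseteq> points X - {a}" if x: "x \<in> points X - {a}" for x
  proof -
    obtain U where U: "U \<in> \<U>" "x \<in> U" using c(2) x by blast
    have Uo: "openin (zariski X) U" "U \<subseteq> points X" using c(2,3) U by auto
    show ?thesis
    proof (cases "a \<in> U")
      case False
      then show ?thesis using Uo U by blast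
    next
      case True
      have V: "V U \<subseteq> affine_space (n U)" using c(4) U closedin_subset topspace_zariski_affine by metis
      have "f U x \<noteq> f U a" using c(7) U True x by (metis DiffE singletonI)
      then obtain k where k: "f U x k \<noteq> f U a k" by blast
      have "f U x \<in> affine_space (n U)" "f U a \<in> affine_space (n U)" using V c(7) U True by blast+
      \<comment> \<open>Points of \<open>affine_space\<close> share one default value at all indices
        from \<open>n U\<close> on, so a differing index lies below \<open>n U\<close>.\<close>
      then have kn: "k < n U" using k PiE_arb[of _ "{..<n U}" "\<lambda>_. UNIV" k]
        unfolding affine_space_def by (metis lessThan_iff)
      let ?p = "\<lambda>v. v k + - f U a k"
      have "openin (zariski_affine (n U)) {v \<in> affine_space (n U). ?p v \<noteq> 0}"
        by (intro openin_nonvanishing_polynomial poly_function.add poly_function.coord poly_function.const kn)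
      then have o: "openin (subtopology (zariski_affine (n U)) (V U)) ({v \<in> affine_space (n U). ?p v \<noteq> 0} \<inter> V U)"
        unfolding openin_subtopology by blast
      have "continuous_map (subtopology (zariski X) U) (subtopology (zariski_affine (n U)) (V U)) (f U)"
        using c(5) U by (auto simp: variety_morphism_def open_subspace_def affine_set_def)
      from openin_continuous_map_preimage[OF this o]
      have "openin (zariski X) {y \<in> topspace (subtopology (zariski X) U). f U y \<in> {v \<in> affine_space (n U). ?p v \<noteq> 0} \<inter> V U}"
        using Uo(1) openin_open_subtopology by blast
      moreover have "{y \<in> topspace (subtopology (zariski X) U). f U y \<in> {v \<in> affine_space (n U). ?p v \<noteq> 0} \<inter> V U}
          = {y \<in> U. f U y k \<noteq> f U a k}" using Uo(2) c(7) U V by auto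
      ultimately show ?thesis using k U Uo(2) by (intro exI[of _ "{y \<in> U. f U y k \<noteq> f U a k}"]) auto
    qed
  qed
  then have "openin (zariski X) (points X - {a})" by (subst openin_subopen) blast
  then show ?thesis using assms(2) by (simp add: closedin_def)
qed

text \<open>The coordinate \<open>(i, 0)\<close> labels the chart containing the value at \<open>i\<close>, and the coordinates
  \<open>(i, Suc k)\<close> are the affine coordinates of this value in that chart.\<close>

lemma configurations_parametrization:
  fixes X :: "('a, 'k::field) function_space"
  assumes K: "infinite (UNIV :: 'k set)" and X: "algebraic_variety X"
  obtains B :: "('g \<times> nat \<Rightarrow> 'k) set" and \<phi> :: "_ \<Rightarrow> 'g \<Rightarrow> 'a"
    where "algebraic_set B" "\<phi> ` B = configurations (points X)"
      "\<forall>i. variety_morphism (algebraic_space B) X (\<lambda>z. \<phi> z i)"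
proof -
  obtain \<U> n V f g where c: "finite \<U>" "\<Union>\<U> = points X" "\<forall>U\<in>\<U>. openin (zariski X) U"
    "\<forall>U\<in>\<U>. closedin (zariski_affine (n U)) (V U)"
    "\<forall>U\<in>\<U>. variety_morphism (open_subspace X U) (affine_set (n U) (V U)) (f U)"
    "\<forall>U\<in>\<U>. variety_morphism (affine_set (n U) (V U)) (open_subspace X U) (g U)"
    "\<forall>U\<in>\<U>. \<forall>x\<in>U. f U x \<in> V U \<and> g U (f U x) = x" "\<forall>U\<in>\<U>. \<forall>v\<in>V U. g U v \<in> U"
    using algebraic_variety_charts[OF X] .
  have X': "space_with_functions X" using X unfolding algebraic_variety_def by blast
  have VA: "V U \<subseteq> affine_space (n U)" if "U \<in> \<U>" for U
    using c(4) that closedin_subset topspace_zariski_affine by metis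
  \<comment> \<open>Distinct constants will label the finitely many charts; infinitude of
    \<open>'k\<close> provides enough of them.\<close>
  obtain T where "finite T" "card T = card \<U>" "T \<subseteq> (UNIV :: 'k set)"
    using infinite_arbitrarily_large[OF K] by metis
  then obtain e where "bij_betw e \<U> T" using finite_same_card_bij[OF c(1)] by metis
  then have e: "inj_on e \<U>" by (simp add: bij_betw_def)
  define v where "v U z i = restrict (\<lambda>k. z (i, Suc k)) {..<n U}" for U and z :: "'g \<times> nat \<Rightarrow> 'k" and i
  define ch where "ch z i = inv_into \<U> e (z (i, 0))" for z :: "'g \<times> nat \<Rightarrow> 'k" and i
  define B where "B = {z. \<forall>i. \<exists>U\<in>\<U>. z (i, 0) = e U \<and> v U z i \<in> V U}"
  define \<phi> where "\<phi> z i = g (ch z i) (v (ch z i) z i)" for z i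
  have ch: "ch z i = U" if "U \<in> \<U>" "z (i, 0) = e U" for z i U
    using e that by (simp add: ch_def)
  have chB: "ch z i \<in> \<U> \<and> z (i, 0) = e (ch z i) \<and> v (ch z i) z i \<in> V (ch z i)" if z: "z \<in> B" for z i
  proof -
    obtain U where "U \<in> \<U>" "z (i, 0) = e U" "v U z i \<in> V U" using z unfolding B_def by blast
    then show ?thesis using ch[of U z i] by simp
  qed
  have vA: "v U z i \<in> affine_space (n U)" for U z i
    by (simp add: v_def affine_space_def)
  have pv: "poly_map (\<lambda>z. p (v U z i))" if "poly_function (n U) p" for p U i
    unfolding v_def by (rule poly_map_poly_function[OF that])
  have plab: "poly_map (\<lambda>z. z (i, 0) - e U)" for i and U
    by (intro poly_map_diff poly_map.intros)
  have "algebraic_set B"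
    unfolding algebraic_set_def
  proof (intro allI impI)
    fix z assume "z \<notin> B"
    then obtain i where i: "\<And>U. U \<in> \<U> \<Longrightarrow> z (i, 0) \<noteq> e U \<or> v U z i \<notin> V U" unfolding B_def by blast
    \<comment> \<open>For each chart, a polynomial that vanishes whenever position \<open>i\<close>
      lies in that chart but not at \<open>z\<close>; the product over all charts separates
      \<open>z\<close> from \<open>B\<close>.\<close>
    have "\<exists>h. poly_map h \<and> h z \<noteq> 0 \<and> (\<forall>y. y (i, 0) = e U \<and> v U y i \<in> V U \<longrightarrow> h y = 0)" if U: "U \<in> \<U>" for U
    proof (cases "z (i, 0) = e U")
      case False
      then show ?thesis by (intro exI[of _ "\<lambda>z. z (i, 0) - e U"]) (simp add: plab)
    next
      case True
      then obtain p where "poly_function (n U) p" "p (v U z i) \<noteq> 0" "\<forall>y\<in>V U. p y = 0"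
        using zariski_affine_separation[OF _ vA, of U "V U" z i] c(4) i[OF U] U by blast
      then show ?thesis by (intro exI[of _ "\<lambda>z. p (v U z i)"]) (simp add: pv)
    qed
    then obtain h where h: "\<And>U. U \<in> \<U> \<Longrightarrow> poly_map (h U)" "\<And>U. U \<in> \<U> \<Longrightarrow> h U z \<noteq> 0"
      "\<And>U y. U \<in> \<U> \<Longrightarrow> y (i, 0) = e U \<Longrightarrow> v U y i \<in> V U \<Longrightarrow> h U y = 0" by metis
    have "(\<Prod>U\<in>\<U>. h U y) = 0" if "y \<in> B" for y
      using chB[OF that, of i] h(3)[of "ch y i" y] c(1) by auto
    then show "\<exists>q. poly_map q \<and> q z \<noteq> 0 \<and> (\<forall>y\<in>B. q y = 0)"
      using h(1,2) c(1) by (intro exI[of _ "\<lambda>z. \<Prod>U\<in>\<U>. h U z"]) (simp add: poly_map_prod)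
  qed
  moreover have "\<phi> z i \<in> points X" if "z \<in> B" for z i
    using chB[OF that, of i] c(2,8) unfolding \<phi>_def by blast
  moreover have "x \<in> \<phi> ` B" if x: "x \<in> configurations (points X)" for x :: "'g \<Rightarrow> 'a"
  proof -
    have "\<exists>U. U \<in> \<U> \<and> x i \<in> U" for i using x c(2) unfolding configurations_def by blast
    then obtain U where U: "\<And>i. U i \<in> \<U>" "\<And>i. x i \<in> U i" by metis
    \<comment> \<open>A chart \<open>U i\<close> is picked at each position; where charts overlap
      \<open>\<phi>\<close> need not be injective, but only its image matters.\<close>
    define z where "z = (\<lambda>(i, m). case m of 0 \<Rightarrow> e (U i) | Suc k \<Rightarrow> f (U i) (x i) k)"
    have fA: "f (U i) (x i) \<in> V (U i)" "g (U i) (f (U i) (x i)) = x i" for i using c(7) U by auto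
    have vz: "v (U i) z i = f (U i) (x i)" for i
    proof -
      have "f (U i) (x i) \<in> {..<n (U i)} \<rightarrow>\<^sub>E UNIV" using fA(1) VA[OF U(1)] unfolding affine_space_def by blast
      from PiE_restrict[OF this] show ?thesis by (simp add: v_def z_def)
    qed
    have z0: "z (i, 0) = e (U i)" for i by (simp add: z_def)
    have "z \<in> B" unfolding B_def using U(1) z0 vz fA(1) by auto
    moreover have "ch z i = U i" for i using ch[OF U(1)] z0 by blast
    then have "\<phi> z = x" by (intro ext) (simp add: \<phi>_def vz fA(2))
    ultimately show ?thesis by blast
  qed
  moreover have "variety_morphism (algebraic_space B) X (\<lambda>z. \<phi> z i)" for i
  proof (rule morphism_from_algebraic_spaceI[OF X'])
    show "(\<lambda>z. \<phi> z i) \<in> B \<rightarrow> points X" using \<open>\<And>z i. z \<in> B \<Longrightarrow> \<phi> z i \<in> points X\<close> by blast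
  next
    fix W F z assume W: "openin (zariski X) W" "regular X W F" "z \<in> B" "\<phi> z i \<in> W"
    let ?U = "ch z i"
    have U: "?U \<in> \<U>" "z (i, 0) = e ?U" "v ?U z i \<in> V ?U" using chB[OF W(3)] by auto
    obtain p q where pq: "poly_function (n ?U) p" "poly_function (n ?U) q" "q (v ?U z i) \<noteq> 0"
        "\<forall>y\<in>V ?U. q y \<noteq> 0 \<longrightarrow> g ?U y \<in> W \<and> F (g ?U y) = p y / q y"
      by (rule regular_in_chart[OF X' bspec[OF c(3) U(1)] bspec[OF c(6) U(1)] VA[OF U(1)] W(1,2) U(3)
        W(4)[unfolded \<phi>_def]])
    \<comment> \<open>\<open>?L y \<noteq> 0\<close> rules out every label but that of
      \<open>?U\<close>, so on this basic set of \<open>B\<close> the chart at \<open>i\<close> is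
      constant and \<open>\<phi> y i\<close> is computed by \<open>g ?U\<close>.\<close>
    let ?L = "\<lambda>y. \<Prod>U'\<in>\<U> - {?U}. y (i, 0) - e U'"
    have L: "poly_map ?L" using c(1) by (intro poly_map_prod plab) auto
    have Lz: "?L z \<noteq> 0"
      using c(1) U(1,2) e by (auto simp: inj_on_def)
    have y: "ch y i = ?U" if y: "y \<in> B" "?L y \<noteq> 0" for y
      using chB[OF y(1), of i] y(2) c(1) by auto
    show "\<exists>p q. poly_map p \<and> poly_map q \<and> q z \<noteq> 0 \<and> (\<forall>y\<in>B. q y \<noteq> 0 \<longrightarrow> \<phi> y i \<in> W \<and> F (\<phi> y i) = p y / q y)"
    proof (rule exI[of _ "\<lambda>y. p (v ?U y i) * ?L y"], rule exI[of _ "\<lambda>y. q (v ?U y i) * ?L y"],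
        intro conjI ballI impI)
      fix y assume y': "y \<in> B" "q (v ?U y i) * ?L y \<noteq> 0"
      then have "\<phi> y i = g ?U (v ?U y i)" "v ?U y i \<in> V ?U" using y[OF y'(1)] chB[OF y'(1), of i]
        by (auto simp: \<phi>_def)
      then show "\<phi> y i \<in> W" "F (\<phi> y i) = (p (v ?U y i) * ?L y) / (q (v ?U y i) * ?L y)"
        using pq(4) y'(2) by auto
    next
      show "poly_map (\<lambda>y. p (v ?U y i) * ?L y)" "poly_map (\<lambda>y. q (v ?U y i) * ?L y)"
        by (rule poly_map.mult[OF pv L], fact)+
    qed (use pq(3) Lz in simp)
  qed
  ultimately show thesis
    by (intro that[of B \<phi>]) (auto simp: configurations_def)
qed

section \<open>Images of subshifts of finite type\<close>

lemma restrict_shift_morphism: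
  assumes X: "space_with_functions X" and Y: "space_with_functions Y" and M: "finite M"
    and \<psi>: "\<And>g. variety_morphism Y X (\<lambda>z. \<psi> z g)"
  shows "variety_morphism Y (power_variety X M) (\<lambda>z. restrict (shift g (\<psi> z)) M)"
proof -
  have "(\<lambda>z. restrict (shift g (\<psi> z)) M) = (\<lambda>z. restrict (\<lambda>m. \<psi> z (- g + m)) M)"
    by (simp add: shift_def)
  then show ?thesis using power_universal_tuple[OF X Y M, of "\<lambda>m z. \<psi> z (- g + m)"] \<psi> by simp
qed

text \<open>Each coordinate of \<open>\<rho> (\<psi> z)\<close> is the local defining morphism after
  a finite tuple of coordinates of \<open>\<psi>\<close>. Thus coordinatewise morphisms, possibly
  from infinitely many variables, survive repeated application of algebraic cellular
  automata.\<close>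

lemma CA_alg_morphism:
  assumes X: "space_with_functions X" and Y: "space_with_functions Y" and \<rho>: "\<rho> \<in> CA_alg X"
    and \<psi>: "\<And>g. variety_morphism Y X (\<lambda>z. \<psi> z g)"
  shows "variety_morphism Y X (\<lambda>z. \<rho> (\<psi> z) g)"
proof -
  obtain M \<mu> where M: "local_defining_map (points X) M \<mu> \<rho>" "variety_morphism (power_variety X M) X \<mu>"
    using \<rho> unfolding CA_alg_def by blast
  have fin: "finite M" using M(1) unfolding local_defining_map_def by blast
  show ?thesis
  proof (rule variety_morphism_cong[OF Y])
    show "variety_morphism Y X (\<mu> \<circ> (\<lambda>z. restrict (shift (- g) (\<psi> z)) M))"
      by (rule variety_morphism_compose[OF restrict_shift_morphism[OF X Y fin \<psi>] M(2)])
  next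
    fix z assume "z \<in> points Y"
    then have "\<psi> z \<in> configurations (points X)"
      unfolding configurations_def using variety_morphism_points[OF \<psi>] by blast
    then show "(\<mu> \<circ> (\<lambda>z. restrict (shift (- g) (\<psi> z)) M)) z = \<rho> (\<psi> z) g"
      using M(1) unfolding local_defining_map_def by simp
  qed
qed

text \<open>\<open>W\<close> is closed in the fibered power, whose topology is finer than the
  product topology, so continuity of the single coordinates would not suffice; by the universal
  property the whole tuple is a morphism.\<close>

lemma closedin_sft_preimage:
  assumes X: "space_with_functions X" and Y: "space_with_functions Y" and \<Lambda>: "algebraic_sft X \<Lambda>"
    and \<psi>: "\<And>g. variety_morphism Y X (\<lambda>z. \<psi> z g)"
  shows "closedin (zariski Y) {z \<in> points Y. \<psi> z \<in> \<Lambda>}"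
proof -
  obtain D W where D: "finite D" "closedin (zariski (power_variety X D)) W" "\<Lambda> = sft (points X) W D"
    using \<Lambda> unfolding algebraic_sft_def by blast
  have "\<psi> z \<in> configurations (points X)" if "z \<in> points Y" for z
    unfolding configurations_def using variety_morphism_points[OF \<psi> that] by blast
  then have "{z \<in> points Y. \<psi> z \<in> \<Lambda>} = (\<Inter>g. {z \<in> points Y. restrict (shift g (\<psi> z)) D \<in> W})"
    unfolding D(3) sft_def by blast
  moreover have "closedin (zariski Y) {z \<in> points Y. restrict (shift g (\<psi> z)) D \<in> W}" for g
    by (rule closedin_continuous_map_preimage[OF _ D(2)])
      (use restrict_shift_morphism[OF X Y D(1) \<psi>] in \<open>simp add: variety_morphism_def\<close>)
  ultimately show ?thesis by (simp add: closedin_INT)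
qed

text \<open>Pulled back along the parametrization \<open>\<phi>\<close>, membership in
  \<open>\<Lambda>\<close> and each equation at a single \<open>g\<close> become closed conditions
  on a compact space. Prescribing values only on \<open>T\<close> permits gluing with a gap; the
  list \<open>\<rho>s\<close>, whose last entry acts first, covers both \<open>\<rho>\<close> and
  \<open>\<sigma>\<close> after \<open>\<rho>\<close>.\<close>

lemma sft_image_closed:
  fixes X :: "('a, 'k::alg_closed_field) function_space" and \<Lambda> :: "('g::group_add \<Rightarrow> 'a) set"
  assumes G: "countable (UNIV :: 'g set)" and K: "uncountable (UNIV :: 'k set)"
    and X: "algebraic_variety X" and \<Lambda>: "algebraic_sft X \<Lambda>" and \<rho>s: "set \<rho>s \<subseteq> CA_alg X"
    and y: "y \<in> T \<rightarrow> points X"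
    and approx: "\<And>F. finite F \<Longrightarrow> F \<subseteq> T \<Longrightarrow> \<exists>w\<in>\<Lambda>. \<forall>g\<in>F. foldr (\<lambda>\<rho>. \<rho>) \<rho>s w g = y g"
  shows "\<exists>w\<in>\<Lambda>. \<forall>g\<in>T. foldr (\<lambda>\<rho>. \<rho>) \<rho>s w g = y g"
proof -
  let ?R = "foldr (\<lambda>\<rho>. \<rho>) \<rho>s"
  have X': "space_with_functions X" using X unfolding algebraic_variety_def by blast
  have "infinite (UNIV :: 'k set)" using K countable_finite by blast
  then obtain B :: "('g \<times> nat \<Rightarrow> 'k) set" and \<phi> :: "_ \<Rightarrow> 'g \<Rightarrow> 'a"
    where B: "algebraic_set B" "\<phi> ` B = configurations (points X)"
      and "\<forall>g. variety_morphism (algebraic_space B) X (\<lambda>z. \<phi> z g)"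
    by (rule configurations_parametrization[OF _ X, where 'g = 'g])
  then have \<phi>: "variety_morphism (algebraic_space B) X (\<lambda>z. \<phi> z g)" for g by blast
  let ?Y = "algebraic_space B"
  note Y = space_algebraic_space[of B]
  have "countable (UNIV :: ('g \<times> nat) set)"
    using countable_SIGMA[OF G, of "\<lambda>_. UNIV :: nat set"] by simp
  then have comp: "compact_space (zariski ?Y)" by (rule compact_algebraic_space[OF K _ B(1)])
  have R: "variety_morphism ?Y X (\<lambda>z. ?R (\<phi> z) g)" for g
    using \<rho>s
  proof (induction \<rho>s arbitrary: g)
    case Nil
    show ?case using \<phi> by simp
  next
    case (Cons \<rho> \<rho>s)
    then show ?case
      using CA_alg_morphism[OF X' Y, of \<rho> "\<lambda>z. foldr (\<lambda>\<rho>. \<rho>) \<rho>s (\<phi> z)"] by simp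
  qed
  define L where "L = {z \<in> B. \<phi> z \<in> \<Lambda>}"
  define C where "C g = {z \<in> B. ?R (\<phi> z) g \<in> {y g}}" for g
  have "closedin (zariski ?Y) L"
    using closedin_sft_preimage[OF X' Y \<Lambda> \<phi>] by (simp add: L_def)
  moreover have "closedin (zariski ?Y) (C g)" if "g \<in> T" for g
  proof -
    have "continuous_map (zariski ?Y) (zariski X) (\<lambda>z. ?R (\<phi> z) g)"
      using R[of g] unfolding variety_morphism_def by (rule conjunct1)
    moreover have "closedin (zariski X) {y g}" using closedin_point[OF X] y that by blast
    ultimately have "closedin (zariski ?Y) {z \<in> points ?Y. ?R (\<phi> z) g \<in> {y g}}"
      by (rule closedin_continuous_map_preimage)
    then show ?thesis by (simp add: C_def)
  qed
  \<comment> \<open>A configuration realising \<open>y\<close> on the finitely many positions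
    involved lifts through \<open>\<phi>\<close> to a common point of all sets in
    \<open>\<F>\<close>.\<close>
  moreover have "\<Inter>\<F> \<noteq> {}" if \<F>: "finite \<F>" "\<F> \<subseteq> insert L (C ` T)" for \<F>
  proof -
    have "finite (\<F> - {L})" "\<F> - {L} \<subseteq> C ` T" using \<F> by auto
    then obtain F where F: "F \<subseteq> T" "finite F" "\<F> - {L} = C ` F" using finite_subset_image by metis
    obtain w where w: "w \<in> \<Lambda>" "\<forall>g\<in>F. ?R w g = y g" using approx[OF F(2,1)] by blast
    have "w \<in> configurations (points X)" using \<Lambda> w(1) unfolding algebraic_sft_def sft_def by blast
    then have "w \<in> \<phi> ` B" using B(2) by simp
    then obtain z where z: "z \<in> B" "\<phi> z = w" by (elim imageE) simp
    have "z \<in> L" "\<And>g. g \<in> F \<Longrightarrow> z \<in> C g" using z w by (auto simp: L_def C_def)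
    then have "z \<in> \<Inter>\<F>" using F(3) by blast
    then show ?thesis by blast
  qed
  ultimately have "\<Inter>(insert L (C ` T)) \<noteq> {}"
    by (intro comp[unfolded compact_space_fip, rule_format]) auto
  then obtain z where "z \<in> L" "\<And>g. g \<in> T \<Longrightarrow> z \<in> C g" by auto
  then show ?thesis by (auto simp: L_def C_def)
qed

section \<open>Density and closedness of the image of \<open>\<tau>\<close>\<close>

theorem theorem5p2:
  fixes X :: "('a, 'k::alg_closed_field) function_space"
    and \<Sigma> :: "('g::group_add \<Rightarrow> 'a) set"
    and \<sigma> \<tau> :: "('g \<Rightarrow> 'a) \<Rightarrow> ('g \<Rightarrow> 'a)"
  assumes "countable (UNIV :: 'g set)"
    and "uncountable (UNIV :: 'k set)"
    and "algebraic_variety X"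
    and "algebraic_sofic_subshift X \<Sigma>"
    and "strongly_irreducible \<Sigma>"
    and "\<sigma> \<in> CA_alg X"
    and "\<tau> \<in> \<Sigma> \<rightarrow> \<Sigma>"
    and "\<forall>x\<in>\<Sigma>. \<tau> x = \<sigma> x"
    and "post_surjective \<Sigma> \<tau>"
  shows "\<tau> ` \<Sigma> = \<Sigma>"
proof
  show "\<tau> ` \<Sigma> \<subseteq> \<Sigma>" using assms(7) by blast
  show "\<Sigma> \<subseteq> \<tau> ` \<Sigma>"
  proof
    fix y assume y: "y \<in> \<Sigma>"
    obtain \<rho> \<Lambda> where \<rho>: "\<rho> \<in> CA_alg X" "algebraic_sft X \<Lambda>" "\<Sigma> = \<rho> ` \<Lambda>"
        and sub: "\<Sigma> \<subseteq> configurations (points X)"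
      using assms(4) unfolding algebraic_sofic_subshift_def subshift_def by blast
    have pts: "x g \<in> points X" if "x \<in> \<Sigma>" for x g
      using sub that unfolding configurations_def by blast
    note closed = sft_image_closed[OF assms(1,2,3) \<rho>(2)]
    obtain \<Delta> where \<Delta>: "finite \<Delta>" and irr: "\<forall>E F. finite E \<and> finite F \<and>
        {e + d | e d. e \<in> E \<and> d \<in> \<Delta>} \<inter> F = {} \<longrightarrow> (\<forall>a\<in>\<Sigma>. \<forall>b\<in>\<Sigma>.
        \<exists>z\<in>\<Sigma>. restrict z E = restrict a E \<and> restrict z F = restrict b F)"
      using assms(5) unfolding strongly_irreducible_def by blast
    have \<tau>y: "\<tau> y \<in> \<Sigma>" using assms(7) y by blast
    have dense: "\<exists>x\<in>\<Sigma>. \<forall>g\<in>E. \<tau> x g = y g" if E: "finite E" for E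
    proof -
      let ?N = "{e + d | e d. e \<in> E \<and> d \<in> \<Delta>}"
      have N: "finite ?N" using finite_image_set2[of "\<lambda>e. e \<in> E" "\<lambda>d. d \<in> \<Delta>" "(+)"] E \<Delta> by simp
      \<comment> \<open>The target is prescribed on \<open>E\<close> and off \<open>?N\<close> only;
        its values on the rest of \<open>?N\<close> are placeholders.\<close>
      define t where "t g = (if g \<in> E then y g else \<tau> y g)" for g
      \<comment> \<open>Strong irreducibility glues over finite sets; closedness of
        \<open>\<Sigma>\<close>, the image of \<open>\<Lambda>\<close> under \<open>\<rho>\<close>,
        extends the gluing to the whole complement of \<open>?N\<close>.\<close>
      have "\<exists>w\<in>\<Lambda>. \<forall>g\<in>E \<union> - ?N. foldr (\<lambda>\<rho>. \<rho>) [\<rho>] w g = t g"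
      proof (rule closed)
        fix F assume F: "finite F" "F \<subseteq> E \<union> - ?N"
        obtain z where z: "z \<in> \<Sigma>" "restrict z E = restrict y E" "restrict z (F - ?N) = restrict (\<tau> y) (F - ?N)"
          using irr[rule_format, of E "F - ?N" y "\<tau> y"] E F(1) y \<tau>y by blast
        have "z g = t g" if "g \<in> F" for g
          using fun_cong[OF z(2), of g] fun_cong[OF z(3), of g] that F(2)
          by (auto simp: t_def split: if_splits)
        moreover obtain w where "w \<in> \<Lambda>" "\<rho> w = z" using z(1) \<rho>(3) by blast
        ultimately show "\<exists>w\<in>\<Lambda>. \<forall>g\<in>F. foldr (\<lambda>\<rho>. \<rho>) [\<rho>] w g = t g" by auto
      qed (use \<rho>(1) pts y \<tau>y in \<open>auto simp: t_def\<close>)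
      then obtain w where "w \<in> \<Lambda>" and w: "\<forall>g\<in>E \<union> - ?N. \<rho> w g = t g" by auto
      then have z: "\<rho> w \<in> \<Sigma>" using \<rho>(3) by blast
      \<comment> \<open>The exceptional set includes \<open>E\<close> besides \<open>?N\<close>,
        since \<open>\<Delta>\<close> need not contain \<open>0\<close>.\<close>
      have "asymptotic (\<rho> w) (\<tau> y)"
        unfolding asymptotic_def
        by (rule exI[of _ "E \<union> ?N"]) (use E N w in \<open>auto simp: t_def fun_eq_iff restrict_def\<close>)
      then obtain x where "x \<in> \<Sigma>" "\<tau> x = \<rho> w"
        using assms(9) y z unfolding post_surjective_def by blast
      moreover from this have "\<forall>g\<in>E. \<tau> x g = y g" using w by (simp add: t_def)
      ultimately show ?thesis by blast
    qed
    \<comment> \<open>The image of \<open>\<tau>\<close> is that of \<open>\<Lambda>\<close> under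
      \<open>\<sigma>\<close> after \<open>\<rho>\<close>; its closedness turns agreement with
      \<open>y\<close> on all finite sets into equality.\<close>
    have "\<exists>w\<in>\<Lambda>. \<forall>g\<in>UNIV. foldr (\<lambda>\<rho>. \<rho>) [\<sigma>, \<rho>] w g = y g"
    proof (rule closed)
      fix F :: "'g set" assume "finite F"
      then obtain x where x: "x \<in> \<Sigma>" "\<forall>g\<in>F. \<tau> x g = y g" using dense by blast
      then obtain w where "w \<in> \<Lambda>" "\<rho> w = x" using \<rho>(3) by blast
      then show "\<exists>w\<in>\<Lambda>. \<forall>g\<in>F. foldr (\<lambda>\<rho>. \<rho>) [\<sigma>, \<rho>] w g = y g" using x assms(8) by auto
    qed (use assms(6) \<rho>(1) pts y in auto)
    then obtain w where w: "w \<in> \<Lambda>" "\<sigma> (\<rho> w) = y" by auto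
    then have "\<rho> w \<in> \<Sigma>" "\<tau> (\<rho> w) = y" using \<rho>(3) assms(8) by auto
    then show "y \<in> \<tau> ` \<Sigma>" by blast
  qed
qed

end
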